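(* Let $\bar x\in\Phi$ be a stationary point of the problem $\min\{f(x):\mathcal G(x)\in\mathcal K\}$ with $(\bar y,\bar z)\in\Lambda(\bar x)\neq\emptyset$. Then: (i) If the second-order sufficient optimality condition holds at $\bar x$ and the SRCQ holds at $\bar x$ with respect to $(\bar y,\bar z)$, then $G^{-1}$ is isolated calm at the origin for $(\bar x,\bar y,\bar z)$. (ii) If $G^{-1}$ is isolated calm at the origin for $(\bar x,\bar y,\bar z)$, then the SRCQ holds at $\bar x$ with respect to $(\bar y,\bar z)$. (iii) If $G^{-1}$ is isolated calm at the origin for $(\bar x,\bar y,\bar z)$ and the quadratic form $$q(d_x,d_x):=\langle d_x,\nabla^2_{xx}\mathcal L(\bar x;\bar y,\bar z)d_x\rangle+2\big\langle\bar y,\ \mathrm D\phi(\bar x)d_x\,[-\phi(\bar x)]^\dagger\,\mathrm D\phi(\bar x)d_x\big\rangle$$ satisfies $q(d_x,d_x)\ge0$ for all $d_x\in\mathcal C(\bar x)$, and $$q(d_x,d_x)=0,\ d_x\in\mathcal C(\bar x)\ \Longrightarrow\ \nabla^2_{xx}\mathcal L(\bar x;\bar y,\bar z)d_x=0,$$ then the second-order sufficient optimality condition holds at $\bar x$.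
   Context: $\mathcal X,\mathcal Z$ are finite-dimensional real Euclidean spaces; $\mathbb S^p$ is the space of $p\times p$ real symmetric matrices with trace inner product, $\mathbb S^p_+$ its cone of positive semi-definite matrices, $\mathbb S^p_-=-\mathbb S^p_+$; $\mathcal Y:=\mathbb S^p\times\mathcal Z$. $f:\mathcal X\to\mathbb R$ and $\mathcal G=(\phi,\psi):\mathcal X\to\mathcal Y$ ($\phi:\mathcal X\to\mathbb S^p$, $\psi:\mathcal X\to\mathcal Z$) are twice continuously differentiable; $\mathcal K=\mathbb S^p_-\times\mathcal P$ with $\mathcal P\subset\mathcal Z$ a nonempty convex polyhedral set. $\Phi=\{x:\mathcal G(x)\in\mathcal K\}$. $N_{\mathcal K}$, $T_{\mathcal K}$ denote normal and tangent cones of convex analysis, $\Pi_{\mathcal K}$ the metric projection, $w^\perp=\{v:\langle v,w\rangle=0\}$, and $S^\dagger$ the Moore–Penrose pseudo-inverse. Lagrangian: $\mathcal L(x;y,z)=f(x)+\langle y,\phi(x)\rangle+\langle z,\psi(x)\rangle$; $\nabla_x\mathcal L$, $\nabla^2_{xx}\mathcal L$ are its first and second derivatives in $x$. $\Lambda(\bar x)$ is the set of $(y,z)\in\mathbb S^p\times\mathcal Z$ with $\nabla_x\mathcal L(\bar x;y,z)=0$ and $(y,z)\in N_{\mathcal K}(\mathcal G(\bar x))$; $\bar x$ is stationary if $\Lambda(\bar x)\ne\emptyset$. SRCQ (strict Robinson constraint qualification) at $\bar x$ with respect to $(\bar y,\bar z)\in\Lambda(\bar x)$: $\mathrm D\mathcal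 G(\bar x)\mathcal X+T_{\mathcal K}(\mathcal G(\bar x))\cap(\bar y,\bar z)^\perp=\mathcal Y$. Critical cone: $\mathcal C(\bar x)=\{d\in\mathcal X:\mathrm D\mathcal G(\bar x)d\in T_{\mathcal K}(\mathcal G(\bar x)),\ \mathrm Df(\bar x)d\le0\}$. Second-order sufficient optimality condition at a stationary point $\bar x$: $$\sup_{(y,z)\in\Lambda(\bar x)}\big\{\langle d,\nabla^2_{xx}\mathcal L(\bar x;y,z)d\rangle+2\langle y,\mathrm D\phi(\bar x)d\,[-\phi(\bar x)]^\dagger\,\mathrm D\phi(\bar x)d\rangle\big\}>0\quad\forall\,0\ne d\in\mathcal C(\bar x).$$ KKT mapping $G:\mathcal X\times\mathbb S^p\times\mathcal Z\to\mathcal X\times\mathbb S^p\times\mathcal Z$: $G(x,y,z)=\big(\nabla_x\mathcal L(x;y,z),\ -\mathcal G(x)+\Pi_{\mathcal K}(\mathcal G(x)+(y,z))\big)$; $G^{-1}$ is its set-valued inverse. A set-valued mapping $F$ is isolated calm at $a$ for $b\in F(a)$ if there are $\kappa_0>0$ and neighborhoods $V$ of $a$, $W$ of $b$ such that $F(a')\cap W\subseteq\{b'':\|b''-b\|\le\kappa_0\|a'-a\|\}$ for all $a'\in V$. *)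

theory Defs
  imports "HOL-Analysis.Analysis"
begin

text \<open>
  The space of symmetric matrices is represented as the subspace \<open>sym_mats\<close> of \<open>real^'p^'p\<close>.
  The inner product that \<open>real^'p^'p\<close> carries in the library is the trace inner product
  (lemma \<open>trace_inner\<close>), so the norm is the Frobenius norm.  Notions that depend on the ambient
  space (normal cones, the strict Robinson condition, the inverse of the KKT mapping) are taken
  relative to the subspace \<open>sym_mats \<times> UNIV\<close>.
\<close>

definition sym_mats :: "(real^'p^'p) set" where
  "sym_mats = {A. transpose A = A}"

definition psd_mats :: "(real^'p^'p) set" where
  "psd_mats = {A \<in> sym_mats. \<forall>v. 0 \<le> v \<bullet> (A *v v)}"

definition nsd_mats :: "(real^'p^'p) set" where
  "nsd_mats = uminus ` psd_mats"

lemma trace_inner: "trace (transpose A ** B) = A \<bullet> B"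
  for A B :: "real^'p^'p"
proof -
  have "trace (transpose A ** B) = (\<Sum>j\<in>UNIV. \<Sum>i\<in>UNIV. A $ i $ j * B $ i $ j)"
    by (simp add: trace_def matrix_matrix_mult_def transpose_def)
  also have "\<dots> = (\<Sum>i\<in>UNIV. \<Sum>j\<in>UNIV. A $ i $ j * B $ i $ j)"
    by (rule sum.swap)
  finally show ?thesis
    by (simp add: inner_vec_def)
qed

definition pinv :: "real^'p^'p \<Rightarrow> real^'p^'p" where
  "pinv A = (THE X. A ** X ** A = A \<and> X ** A ** X = X \<and>
     transpose (A ** X) = A ** X \<and> transpose (X ** A) = X ** A)"

definition twice_cont_diff :: "('a::euclidean_space \<Rightarrow> 'b::euclidean_space) \<Rightarrow> bool" where
  "twice_cont_diff g \<longleftrightarrow>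
     (\<exists>(g' :: 'a \<Rightarrow> 'a \<Rightarrow>\<^sub>L 'b) (g'' :: 'a \<Rightarrow> 'a \<Rightarrow>\<^sub>L ('a \<Rightarrow>\<^sub>L 'b)).
        (\<forall>x. (g has_derivative blinfun_apply (g' x)) (at x)) \<and>
        (\<forall>x. (g' has_derivative blinfun_apply (g'' x)) (at x)) \<and>
        continuous_on UNIV g'')"

abbreviation Der :: "('a::euclidean_space \<Rightarrow> 'b::euclidean_space) \<Rightarrow> 'a \<Rightarrow> 'a \<Rightarrow> 'b" where
  "Der g x \<equiv> frechet_derivative g (at x)"

definition grad :: "('a::euclidean_space \<Rightarrow> real) \<Rightarrow> 'a \<Rightarrow> 'a" where
  "grad g x = (THE D. GDERIV g x :> D)"

text \<open>By convention both cones are empty at points outside the convex set \<open>K\<close>; the normal cone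
  is the one formed in the subspace \<open>E\<close>.\<close>

definition normal_cone :: "'a::euclidean_space set \<Rightarrow> 'a set \<Rightarrow> 'a \<Rightarrow> 'a set" where
  "normal_cone E K u = {w \<in> E. u \<in> K \<and> (\<forall>k\<in>K. w \<bullet> (k - u) \<le> 0)}"

definition tangent_cone :: "'a::euclidean_space set \<Rightarrow> 'a \<Rightarrow> 'a set" where
  "tangent_cone K u = (if u \<in> K then closure (cone hull ((\<lambda>k. k - u) ` K)) else {})"

text \<open>The membership \<open>b \<in> F a\<close> is part of the definition.\<close>

definition isolated_calm ::
    "('a::real_normed_vector \<Rightarrow> 'b::real_normed_vector set) \<Rightarrow> 'a \<Rightarrow> 'b \<Rightarrow> bool" where
  "isolated_calm F a b \<longleftrightarrow> b \<in> F a \<and>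
     (\<exists>\<kappa>>0. \<exists>V W. open V \<and> a \<in> V \<and> open W \<and> b \<in> W \<and>
        (\<forall>a'\<in>V. F a' \<inter> W \<subseteq> {b''. norm (b'' - b) \<le> \<kappa> * norm (a' - a)}))"

definition Yspace :: "((real^'p^'p) \<times> 'z::euclidean_space) set" where
  "Yspace = sym_mats \<times> UNIV"

definition Kset :: "'z::euclidean_space set \<Rightarrow> ((real^'p^'p) \<times> 'z) set" where
  "Kset P = nsd_mats \<times> P"

definition Gmap :: "('x::euclidean_space \<Rightarrow> real^'p^'p) \<Rightarrow> ('x \<Rightarrow> 'z::euclidean_space)
    \<Rightarrow> 'x \<Rightarrow> (real^'p^'p) \<times> 'z" where
  "Gmap \<phi> \<psi> x = (\<phi> x, \<psi> x)"

definition feasible_set :: "('x::euclidean_space \<Rightarrow> real^'p^'p) \<Rightarrow> ('x \<Rightarrow> 'z::euclidean_space)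
    \<Rightarrow> 'z set \<Rightarrow> 'x set" where
  "feasible_set \<phi> \<psi> P = {x. Gmap \<phi> \<psi> x \<in> Kset P}"

definition lagrangian :: "('x::euclidean_space \<Rightarrow> real) \<Rightarrow> ('x \<Rightarrow> real^'p^'p)
    \<Rightarrow> ('x \<Rightarrow> 'z::euclidean_space) \<Rightarrow> real^'p^'p \<Rightarrow> 'z \<Rightarrow> 'x \<Rightarrow> real" where
  "lagrangian f \<phi> \<psi> y z x = f x + y \<bullet> \<phi> x + z \<bullet> \<psi> x"

definition gradL :: "('x::euclidean_space \<Rightarrow> real) \<Rightarrow> ('x \<Rightarrow> real^'p^'p)
    \<Rightarrow> ('x \<Rightarrow> 'z::euclidean_space) \<Rightarrow> real^'p^'p \<Rightarrow> 'z \<Rightarrow> 'x \<Rightarrow> 'x" where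
  "gradL f \<phi> \<psi> y z x = grad (lagrangian f \<phi> \<psi> y z) x"

text \<open>The second derivative in \<open>x\<close>, as the linear operator \<open>d \<mapsto> \<nabla>\<^sup>2L d\<close>.\<close>

definition hessL :: "('x::euclidean_space \<Rightarrow> real) \<Rightarrow> ('x \<Rightarrow> real^'p^'p)
    \<Rightarrow> ('x \<Rightarrow> 'z::euclidean_space) \<Rightarrow> real^'p^'p \<Rightarrow> 'z \<Rightarrow> 'x \<Rightarrow> 'x \<Rightarrow> 'x" where
  "hessL f \<phi> \<psi> y z x = Der (gradL f \<phi> \<psi> y z) x"

definition multipliers :: "('x::euclidean_space \<Rightarrow> real) \<Rightarrow> ('x \<Rightarrow> real^'p^'p)
    \<Rightarrow> ('x \<Rightarrow> 'z::euclidean_space) \<Rightarrow> 'z set \<Rightarrow> 'x \<Rightarrow> ((real^'p^'p) \<times> 'z) set" where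
  "multipliers f \<phi> \<psi> P x =
     {(y, z). gradL f \<phi> \<psi> y z x = 0 \<and>
              (y, z) \<in> normal_cone Yspace (Kset P) (Gmap \<phi> \<psi> x)}"

definition stationary :: "('x::euclidean_space \<Rightarrow> real) \<Rightarrow> ('x \<Rightarrow> real^'p^'p)
    \<Rightarrow> ('x \<Rightarrow> 'z::euclidean_space) \<Rightarrow> 'z set \<Rightarrow> 'x \<Rightarrow> bool" where
  "stationary f \<phi> \<psi> P x \<longleftrightarrow> multipliers f \<phi> \<psi> P x \<noteq> {}"

definition SRCQ :: "('x::euclidean_space \<Rightarrow> real^'p^'p) \<Rightarrow> ('x \<Rightarrow> 'z::euclidean_space)
    \<Rightarrow> 'z set \<Rightarrow> 'x \<Rightarrow> real^'p^'p \<Rightarrow> 'z \<Rightarrow> bool" where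
  "SRCQ \<phi> \<psi> P x y z \<longleftrightarrow>
     {u + v | u v. u \<in> range (Der (Gmap \<phi> \<psi>) x) \<and>
        v \<in> tangent_cone (Kset P) (Gmap \<phi> \<psi> x) \<inter> {w. w \<bullet> (y, z) = 0}} = Yspace"

definition critical_cone :: "('x::euclidean_space \<Rightarrow> real) \<Rightarrow> ('x \<Rightarrow> real^'p^'p)
    \<Rightarrow> ('x \<Rightarrow> 'z::euclidean_space) \<Rightarrow> 'z set \<Rightarrow> 'x \<Rightarrow> 'x set" where
  "critical_cone f \<phi> \<psi> P x =
     {d. Der (Gmap \<phi> \<psi>) x d \<in> tangent_cone (Kset P) (Gmap \<phi> \<psi> x) \<and> Der f x d \<le> 0}"

definition qform :: "('x::euclidean_space \<Rightarrow> real) \<Rightarrow> ('x \<Rightarrow> real^'p^'p)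
    \<Rightarrow> ('x \<Rightarrow> 'z::euclidean_space) \<Rightarrow> real^'p^'p \<Rightarrow> 'z \<Rightarrow> 'x \<Rightarrow> 'x \<Rightarrow> real" where
  "qform f \<phi> \<psi> y z x d =
     d \<bullet> hessL f \<phi> \<psi> y z x d + 2 * (y \<bullet> (Der \<phi> x d ** pinv (- \<phi> x) ** Der \<phi> x d))"

text \<open>The multiplier set may be unbounded, so the supremum is taken in the extended reals.\<close>

definition SOSC :: "('x::euclidean_space \<Rightarrow> real) \<Rightarrow> ('x \<Rightarrow> real^'p^'p)
    \<Rightarrow> ('x \<Rightarrow> 'z::euclidean_space) \<Rightarrow> 'z set \<Rightarrow> 'x \<Rightarrow> bool" where
  "SOSC f \<phi> \<psi> P x \<longleftrightarrow>
     (\<forall>d \<in> critical_cone f \<phi> \<psi> P x. d \<noteq> 0 \<longrightarrow>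
        (SUP (y, z) \<in> multipliers f \<phi> \<psi> P x. ereal (qform f \<phi> \<psi> y z x d)) > 0)"

definition KKT :: "('x::euclidean_space \<Rightarrow> real) \<Rightarrow> ('x \<Rightarrow> real^'p^'p)
    \<Rightarrow> ('x \<Rightarrow> 'z::euclidean_space) \<Rightarrow> 'z set
    \<Rightarrow> 'x \<times> (real^'p^'p) \<times> 'z \<Rightarrow> 'x \<times> (real^'p^'p) \<times> 'z" where
  "KKT f \<phi> \<psi> P = (\<lambda>(x, y, z).
     (gradL f \<phi> \<psi> y z x,
      - Gmap \<phi> \<psi> x + closest_point (Kset P) (Gmap \<phi> \<psi> x + (y, z))))"

text \<open>The set-valued inverse of the KKT mapping restricted to points with symmetric \<open>y\<close>.  When
  \<open>\<phi>\<close> has symmetric values its domain consists of such points too, so it makes no difference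
  whether neighborhoods of the origin are taken in the full product space or in the subspace.\<close>

definition KKT_inv :: "('x::euclidean_space \<Rightarrow> real) \<Rightarrow> ('x \<Rightarrow> real^'p^'p)
    \<Rightarrow> ('x \<Rightarrow> 'z::euclidean_space) \<Rightarrow> 'z set
    \<Rightarrow> 'x \<times> (real^'p^'p) \<times> 'z \<Rightarrow> ('x \<times> (real^'p^'p) \<times> 'z) set" where
  "KKT_inv f \<phi> \<psi> P a = {w \<in> UNIV \<times> Yspace. KKT f \<phi> \<psi> P w = a}"

end

theory Submission
  imports Defs
begin

text \<open>
  At \<open>(xb, yb, zb)\<close> the matrices \<open>S = - \<phi> xb\<close> and \<open>yb\<close> are positive semidefinite with
  \<open>S ** yb = 0\<close>, and \<open>zb\<close> is normal to the polyhedron \<open>P\<close> at \<open>\<psi> xb\<close>.  A point \<open>(x, y, z)\<close> has KKT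
  residual \<open>(a, b, c)\<close> iff \<open>a\<close> is the gradient of the Lagrangian and the complementarity conditions
  hold \<^emph>\<open>exactly\<close> for the shifted data \<open>\<phi> x + b\<close>, \<open>\<psi> x + c\<close>, \<open>y - b\<close>, \<open>z - c\<close> (\<open>KKT_inv_iff\<close>).  So the
  metric projection never has to be differentiated; it suffices to linearize equations such as
  \<open>y ** S = 0\<close> along sequences.  Below \<open>h\<close> and \<open>k\<close> are the derivatives of \<open>\<phi>\<close> and \<open>\<psi>\<close> at \<open>xb\<close> in the
  direction \<open>x\<close>.

  (i) If isolated calmness fails, points approach \<open>(xb, yb, zb)\<close> along some unit direction
  \<open>(x, y, z)\<close> with residuals of smaller order than the distance.  Dividing the equation
  \<open>y\<^sub>n ** S\<^sub>n = 0\<close> by the step length gives \<open>y ** S = yb ** h\<close> in the limit, and restricting it to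
  \<open>ker S \<inter> ker yb\<close> gives one more, second-order equation (\<open>complementarity_limits\<close>).  By linear
  algebra these two yield \<open>y \<bullet> h = 2 (yb \<bullet> h S\<^sup>\<dagger> h)\<close> (\<open>graphical_derivative_curvature\<close>), which is the
  curvature term of the quadratic form \<open>q\<close>.  Together with the linearized Lagrangian equation and
  \<open>z \<bullet> k \<ge> 0\<close> this gives \<open>q(x) \<le> 0\<close> for the critical direction \<open>x\<close>.  The strict Robinson condition
  makes the multiplier unique, so the second-order condition speaks about this \<open>q\<close>, and \<open>x = 0\<close>.
  Then \<open>(y, z)\<close> is orthogonal to the range of the constraint derivative and nonpositive on the
  critical part of the tangent cone; the strict Robinson condition leaves only \<open>(y, z) = 0\<close>,
  contradicting the unit norm.

  (ii) If the strict Robinson condition fails, separation of convex cones produces a nonzero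
  \<open>(\<delta>, \<zeta>)\<close> of the kind just excluded (\<open>SRCQ_iff\<close>).  The multiplier can be moved in this direction: on
  the polyhedral side \<open>zb + t \<zeta>\<close> stays normal for small \<open>t\<close>, and on the matrix side \<open>yb + t \<delta>\<close> becomes
  positive semidefinite after adding a term of order \<open>t\<^sup>2\<close> (\<open>psd_second_order_curve\<close>).  Complementarity
  is kept and the gradient changes only by \<open>O(t\<^sup>2)\<close>, which contradicts isolated calmness.

  (iii) Since \<open>q \<ge> 0\<close> on the critical cone, it remains to exclude a nonzero critical \<open>x\<close> with
  \<open>q(x) = 0\<close>.  There the Hessian term vanishes by hypothesis, hence so does the curvature term, and
  this forces \<open>yb ** h = 0\<close> (\<open>zero_curvature\<close>).  The same second-order curve, now in the primal cone,
  shows that \<open>(xb + t x, yb, zb)\<close> has residual \<open>o(t)\<close>, so isolated calmness gives \<open>x = 0\<close>.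
\<close>

section \<open>Matrix algebra and the trace inner product\<close>

lemma bounded_bilinear_matrix_mult:
  "bounded_bilinear ((**) :: real^'n^'m \<Rightarrow> real^'k^'n \<Rightarrow> real^'k^'m)"
proof -
  have "bilinear ((**) :: real^'n^'m \<Rightarrow> real^'k^'n \<Rightarrow> real^'k^'m)"
    unfolding bilinear_def linear_iff
    by (auto simp: matrix_matrix_mult_def vec_eq_iff sum.distrib sum_distrib_left algebra_simps)
  then show ?thesis
    by (simp add: bilinear_conv_bounded_bilinear)
qed

interpretation mat_mult: bounded_bilinear "(**) :: real^'n^'m \<Rightarrow> real^'k^'n \<Rightarrow> real^'k^'m"
  by (rule bounded_bilinear_matrix_mult)

lemma bounded_linear_transpose: "bounded_linear (transpose :: real^'n^'m \<Rightarrow> real^'m^'n)"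
  unfolding linear_conv_bounded_linear[symmetric] linear_iff
  by (simp add: transpose_def vec_eq_iff)

lemma linear_transpose: "linear (transpose :: real^'n^'m \<Rightarrow> real^'m^'n)"
  by (rule bounded_linear.linear[OF bounded_linear_transpose])

lemmas matrix_distribs = mat_mult.add_left mat_mult.add_right mat_mult.diff_left mat_mult.diff_right
  mat_mult.minus_left mat_mult.minus_right mat_mult.scaleR_left mat_mult.scaleR_right
  mat_mult.zero_left mat_mult.zero_right matrix_mul_lid matrix_mul_rid

lemmas transpose_distribs = linear_add[OF linear_transpose] linear_diff[OF linear_transpose]
  linear_neg[OF linear_transpose] linear_scale[OF linear_transpose] linear_0[OF linear_transpose]
  matrix_transpose_mul transpose_transpose transpose_mat

lemma inner_matrix_mult_left: "(A ** B) \<bullet> C = B \<bullet> (transpose A ** C)"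
  for A B C :: "real^'p^'p"
  by (simp flip: trace_inner add: matrix_transpose_mul matrix_mul_assoc)

lemma inner_matrix_mult_right: "(A ** B) \<bullet> C = A \<bullet> (C ** transpose B)"
  for A B C :: "real^'p^'p"
  by (metis trace_inner trace_mul_sym matrix_transpose_mul matrix_mul_assoc)

lemma inner_mult_vec: "(A *v x) \<bullet> y = x \<bullet> (transpose A *v y)" for A :: "real^'n^'m"
  by (simp add: dot_lmul_matrix inner_commute)
     (metis dot_lmul_matrix inner_commute)

lemma zero_matrix_iff: "A = 0 \<longleftrightarrow> (\<forall>x. A *v x = 0)" for A :: "real^'n^'m"
  by (metis matrix_eq matrix_vector_mult_0)

definition outer :: "real^'p \<Rightarrow> real^'p^'p" where
  "outer c = (\<chi> i j. c $ i * c $ j)"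

lemma outer_mult_vec: "outer c *v x = (c \<bullet> x) *\<^sub>R c"
  by (simp add: outer_def matrix_vector_mult_def vec_eq_iff inner_vec_def sum_distrib_left
      sum_distrib_right algebra_simps)

lemma transpose_outer: "transpose (outer c) = outer c"
  by (simp add: outer_def transpose_def mult.commute)

lemma outer_inner: "outer c \<bullet> B = c \<bullet> (B *v c)"
  by (simp add: outer_def inner_vec_def matrix_vector_mult_def sum_distrib_left algebra_simps)

lemma outer_mult: "outer c ** B = 0" if "transpose B *v c = 0"
  unfolding zero_matrix_iff
proof
  fix x
  have "(outer c ** B) *v x = (c \<bullet> (B *v x)) *\<^sub>R c"
    by (simp flip: matrix_vector_mul_assoc add: outer_mult_vec)
  also have "c \<bullet> (B *v x) = (transpose B *v c) \<bullet> x"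
    unfolding inner_mult_vec by simp
  finally show "(outer c ** B) *v x = 0"
    by (simp only: that inner_zero_left scaleR_zero_left)
qed

section \<open>Positive semidefinite matrices\<close>

lemma psd_mats_iff: "A \<in> psd_mats \<longleftrightarrow> transpose A = A \<and> (\<forall>v. 0 \<le> v \<bullet> (A *v v))"
  by (simp add: psd_mats_def sym_mats_def)

lemma psd_symD: "A \<in> psd_mats \<Longrightarrow> transpose A = A"
  by (simp add: psd_mats_iff)

lemma psd_ge0: "A \<in> psd_mats \<Longrightarrow> 0 \<le> v \<bullet> (A *v v)"
  by (simp add: psd_mats_iff)

lemma nsd_mats_iff: "A \<in> nsd_mats \<longleftrightarrow> - A \<in> psd_mats"
  unfolding nsd_mats_def by (metis imageE imageI minus_minus)

lemma psd_zero: "0 \<in> psd_mats"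
  by (simp add: psd_mats_iff transpose_distribs)

lemma psd_add: "A \<in> psd_mats \<Longrightarrow> B \<in> psd_mats \<Longrightarrow> A + B \<in> psd_mats"
  by (simp add: psd_mats_iff transpose_distribs matrix_vector_mult_add_rdistrib inner_add_right)

lemma psd_scaleR: "0 \<le> c \<Longrightarrow> A \<in> psd_mats \<Longrightarrow> c *\<^sub>R A \<in> psd_mats"
  by (simp add: psd_mats_iff transpose_distribs flip: scaleR_matrix_vector_assoc)

lemma psd_congruence: "A \<in> psd_mats \<Longrightarrow> transpose X ** A ** X \<in> psd_mats"
proof -
  assume A: "A \<in> psd_mats"
  have "v \<bullet> ((transpose X ** A ** X) *v v) = (X *v v) \<bullet> (A *v (X *v v))" for v
    unfolding inner_mult_vec by (simp only: matrix_vector_mul_assoc matrix_mul_assoc)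
  then show ?thesis
    using A by (simp add: psd_mats_iff transpose_distribs matrix_mul_assoc del: transpose_matrix_vector)
qed

lemma psd_outer: "outer c \<in> psd_mats"
  by (simp add: psd_mats_iff transpose_outer outer_mult_vec inner_commute)

lemma closed_psd_mats: "closed (psd_mats :: (real^'p^'p) set)"
proof -
  have eq: "(psd_mats :: (real^'p^'p) set) = {A. transpose A = A} \<inter> (\<Inter>v. {A. 0 \<le> outer v \<bullet> A})"
    by (auto simp: psd_mats_iff outer_inner)
  have 1: "closed {A :: real^'p^'p. transpose A = A}"
    by (intro closed_Collect_eq linear_continuous_on bounded_linear_transpose continuous_on_id)
  have 2: "closed (\<Inter>v. {A :: real^'p^'p. 0 \<le> outer v \<bullet> A})"
    by (intro closed_INT ballI closed_Collect_le continuous_intros)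
  show ?thesis unfolding eq using 1 2 by (rule closed_Int)
qed

text \<open>At a zero of a nonnegative quadratic form the gradient \<open>2 A v\<close> must vanish; here this is read off by
  moving from \<open>v\<close> in the direction \<open>- A v\<close>.\<close>

lemma psd_quadratic_zero:
  assumes "A \<in> psd_mats" and "v \<bullet> (A *v v) = 0"
  shows "A *v v = 0"
proof -
  define w where "w = A *v v"
  have sym: "v \<bullet> (A *v w) = w \<bullet> w"
    by (metis assms(1) inner_mult_vec psd_symD w_def)
  have quad: "0 \<le> 2 * s * (w \<bullet> w) + s\<^sup>2 * (w \<bullet> (A *v w))" for s :: real
  proof -
    have "(v + s *\<^sub>R w) \<bullet> (A *v (v + s *\<^sub>R w))
        = v \<bullet> (A *v v) + s * (v \<bullet> (A *v w)) + s * (w \<bullet> (A *v v)) + s\<^sup>2 * (w \<bullet> (A *v w))"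
      by (simp add: matrix_vector_right_distrib matrix_vector_mult_scaleR inner_simps
          power2_eq_square algebra_simps)
    then show ?thesis
      using psd_ge0[OF assms(1), of "v + s *\<^sub>R w"] assms(2) sym by (simp add: w_def[symmetric])
  qed
  have "0 \<le> - w \<bullet> w"
  proof (rule tendsto_lowerbound)
    show "((\<lambda>s. - (w \<bullet> w) + s / 2 * (w \<bullet> (A *v w))) \<longlongrightarrow> - w \<bullet> w) (at_right 0)"
      by (auto intro!: tendsto_eq_intros)
    show "\<forall>\<^sub>F s in at_right 0. 0 \<le> - (w \<bullet> w) + s / 2 * (w \<bullet> (A *v w))"
    proof (rule eventually_mono[OF eventually_at_right_less])
      fix s :: real assume s: "0 < s"
      have "0 \<le> 2 * s * (- (w \<bullet> w) + s / 2 * (w \<bullet> (A *v w)))"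
        using quad[of "- s"] by (simp add: power2_eq_square algebra_simps)
      then show "0 \<le> - (w \<bullet> w) + s / 2 * (w \<bullet> (A *v w))"
        using s by (simp add: zero_le_mult_iff)
    qed
  qed simp
  then have "w \<bullet> w \<le> 0" by simp
  then have "w \<bullet> w = 0" using inner_ge_zero[of w] by (rule order_antisym)
  then show ?thesis by (simp add: w_def)
qed

text \<open>Both claims are immediate when \<open>A\<close> is of the form \<open>outer c\<close>, and they pass to sums of positive
  semidefinite matrices.  Subtracting \<open>outer (A v)\<close> divided by \<open>v \<bullet> A v\<close> from \<open>A\<close> leaves a positive
  semidefinite matrix whose kernel has gained \<open>v\<close>, so induction on the codimension of the kernel
  reduces the general case to this one, without any spectral decomposition.\<close>

lemma psd_inner_deflation:
  fixes A B :: "real^'p^'p"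
  assumes "A \<in> psd_mats" and "B \<in> psd_mats"
  shows "0 \<le> A \<bullet> B \<and> (A \<bullet> B = 0 \<longrightarrow> A ** B = 0)"
  using assms(1)
proof (induction "CARD('p) - dim {x. A *v x = 0}" arbitrary: A rule: less_induct)
  case (less A)
  show ?case
  proof (cases "\<forall>v. v \<bullet> (A *v v) = 0")
    case True
    then have "A = 0"
      unfolding zero_matrix_iff using psd_quadratic_zero[OF less.prems] by blast
    then show ?thesis by (simp add: mat_mult.zero_left)
  next
    case False
    then obtain v where v: "v \<bullet> (A *v v) > 0"
      using psd_ge0[OF less.prems] by (auto simp: order_less_le)
    define a where "a = v \<bullet> (A *v v)"
    define c where "c = (1 / sqrt a) *\<^sub>R (A *v v)"
    define A' where "A' = A - outer c"
    have symA: "x \<bullet> (A *v y) = (A *v x) \<bullet> y" for x y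
      by (metis inner_mult_vec less.prems psd_symD)
    have cx: "outer c *v x = (((A *v v) \<bullet> x) / a) *\<^sub>R (A *v v)" for x
      using v by (simp add: outer_mult_vec c_def a_def)
    have A'x: "A' *v x = A *v (x - (((A *v v) \<bullet> x) / a) *\<^sub>R v)" for x
      by (simp add: A'_def cx matrix_vector_mult_diff_rdistrib matrix_vector_mult_diff_distrib
          matrix_vector_mult_scaleR)
    have psd: "A' \<in> psd_mats"
      unfolding psd_mats_iff
    proof (intro conjI allI)
      show "transpose A' = A'"
        using less.prems by (simp add: A'_def transpose_distribs transpose_outer psd_symD)
      fix x
      \<comment> \<open>Completing the square: \<open>r\<close> makes \<open>x - r v\<close> orthogonal to \<open>v\<close> with respect to \<open>A\<close>.\<close>
      define r where "r = ((A *v v) \<bullet> x) / a"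
      have "(x - r *\<^sub>R v) \<bullet> (A *v (x - r *\<^sub>R v)) = x \<bullet> (A' *v x) - r * ((A *v v) \<bullet> (x - r *\<^sub>R v))"
        by (simp add: A'x r_def[symmetric] inner_diff_left symA[of v])
      also have "(A *v v) \<bullet> (x - r *\<^sub>R v) = 0"
        using v by (simp add: inner_diff_right r_def a_def inner_commute)
      finally show "0 \<le> x \<bullet> (A' *v x)"
        using psd_ge0[OF less.prems, of "x - r *\<^sub>R v"] by simp
    qed
    have sub: "{x. A *v x = 0} \<subset> {x. A' *v x = 0}"
    proof
      show "{x. A *v x = 0} \<subseteq> {x. A' *v x = 0}"
        by (auto simp: A'_def matrix_vector_mult_diff_rdistrib cx symA[symmetric])
      have "A' *v v = 0"
        using v by (simp add: A'x a_def inner_commute)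
      moreover have "A *v v \<noteq> 0" using v by auto
      ultimately show "{x. A *v x = 0} \<noteq> {x. A' *v x = 0}" by blast
    qed
    have "dim {x. A *v x = 0} < dim {x. A' *v x = 0}"
    proof (rule dim_psubset)
      have "subspace {x. M *v x = 0}" for M :: "real^'p^'p"
        by (rule subspaceI) (auto simp: matrix_vector_right_distrib matrix_vector_mult_scaleR)
      then show "span {x. A *v x = 0} \<subset> span {x. A' *v x = 0}"
        using sub by (metis span_eq_iff)
    qed
    then have IH: "0 \<le> A' \<bullet> B \<and> (A' \<bullet> B = 0 \<longrightarrow> A' ** B = 0)"
      using less.hyps[OF _ psd] dim_subset_UNIV_cart[of "{x. A' *v x = 0}"] by simp
    have A: "A = outer c + A'" by (simp add: A'_def)
    have AB: "A \<bullet> B = c \<bullet> (B *v c) + A' \<bullet> B"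
      by (simp add: A inner_add_left outer_inner)
    have cB: "c \<bullet> (B *v c) \<ge> 0" by (rule psd_ge0[OF assms(2)])
    show ?thesis
    proof (intro conjI impI)
      show "0 \<le> A \<bullet> B" using AB cB IH by simp
      assume "A \<bullet> B = 0"
      then have "A' \<bullet> B = 0" "c \<bullet> (B *v c) = 0" using AB cB IH by auto
      then have "A' ** B = 0" "transpose B *v c = 0"
        using IH psd_quadratic_zero[OF assms(2)] psd_symD[OF assms(2)] by auto
      then show "A ** B = 0"
        by (simp add: A mat_mult.add_left outer_mult)
    qed
  qed
qed

lemma psd_inner_nonneg: "A \<in> psd_mats \<Longrightarrow> B \<in> psd_mats \<Longrightarrow> 0 \<le> A \<bullet> B"
  using psd_inner_deflation by blast

lemma psd_inner_zero: "A \<in> psd_mats \<Longrightarrow> B \<in> psd_mats \<Longrightarrow> A \<bullet> B = 0 \<Longrightarrow> A ** B = 0"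
  using psd_inner_deflation by blast

lemma inner_congruence:
  fixes A B P :: "real^'p^'p"
  assumes "transpose P = P"
  shows "(P ** A ** P) \<bullet> B = A \<bullet> (P ** B ** P)"
proof -
  have "(P ** A ** P) \<bullet> B = (P ** A) \<bullet> (B ** P)"
    by (simp add: inner_matrix_mult_right[of "P ** A"] assms)
  also have "\<dots> = A \<bullet> (P ** (B ** P))"
    by (simp add: inner_matrix_mult_left[of P] assms)
  finally show ?thesis by (simp add: matrix_mul_assoc)
qed

text \<open>\<open>matrix_mul_assoc\<close> brackets products to the left, so an equation for \<open>A ** B\<close> is no longer visible
  inside \<open>X ** A ** B\<close>; this form of the equation applies there.\<close>

lemma mult_assoc_cong: "A ** B = C \<Longrightarrow> X ** A ** B = X ** C"
  for A B C X :: "real^'p^'p"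
  by (simp flip: matrix_mul_assoc)

section \<open>The pseudo-inverse of a symmetric matrix\<close>

lemma orthogonal_projection_onto_kernel:
  fixes A :: "real^'p^'p"
  obtains N where "transpose N = N" "A ** N = 0" "\<And>x. A *v x = 0 \<Longrightarrow> N *v x = x"
proof -
  have "subspace {x. A *v x = 0}"
    by (rule subspaceI) (auto simp: matrix_vector_right_distrib matrix_vector_mult_scaleR)
  then obtain U where U: "U \<subseteq> {x. A *v x = 0}" "pairwise orthogonal U" "\<And>x. x \<in> U \<Longrightarrow> norm x = 1"
      "independent U" "span U = {x. A *v x = 0}"
    by (metis orthonormal_basis_subspace)
  have fin: "finite U" by (rule independent_imp_finite[OF U(4)])
  define N where "N = (\<Sum>u\<in>U. outer u)"
  have Nx: "N *v x = (\<Sum>u\<in>U. (u \<bullet> x) *\<^sub>R u)" for x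
    unfolding N_def using fin
    by (induction U rule: finite_induct) (auto simp: matrix_vector_mult_add_rdistrib outer_mult_vec)
  show ?thesis
  proof
    show "transpose N = N"
      unfolding N_def by (simp add: linear_sum[OF linear_transpose] transpose_outer)
    have "A *v (N *v x) = 0" for x
      using U(1) by (auto simp: Nx linear_sum[OF matrix_vector_mul_linear] matrix_vector_mult_scaleR
          intro!: sum.neutral)
    then show "A ** N = 0"
      unfolding zero_matrix_iff by (simp add: matrix_vector_mul_assoc)
    fix x assume "A *v x = 0"
    then have "x \<in> span U" using U(5) by simp
    then show "N *v x = x"
    proof (induction rule: span_induct)
      case base
      show ?case
        by (rule subspaceI) (auto simp: matrix_vector_right_distrib matrix_vector_mult_scaleR)
    next
      case (step u)
      have "N *v u = (\<Sum>w\<in>U. (if w = u then u else 0))"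
        unfolding Nx
      proof (rule sum.cong)
        fix w assume w: "w \<in> U"
        show "(w \<bullet> u) *\<^sub>R w = (if w = u then u else 0)"
          using U(2) U(3)[OF step] w step
          by (auto simp: pairwise_def orthogonal_def norm_eq_1)
      qed simp
      then show ?case using fin step by simp
    qed
  qed
qed

text \<open>The Penrose equations give \<open>A ** X = A ** Y\<close> and \<open>X ** A = Y ** A\<close>, since each of these pairs
  consists of orthogonal projections with the same range.\<close>

lemma pinv_unique:
  fixes A X Y :: "real^'p^'p"
  assumes X: "A ** X ** A = A" "X ** A ** X = X" "transpose (A ** X) = A ** X" "transpose (X ** A) = X ** A"
    and Y: "A ** Y ** A = A" "Y ** A ** Y = Y" "transpose (A ** Y) = A ** Y" "transpose (Y ** A) = Y ** A"
  shows "X = Y"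
proof -
  have "A ** X = (A ** Y) ** (A ** X)" using Y(1) by (simp add: matrix_mul_assoc)
  also have "\<dots> = transpose ((A ** X) ** (A ** Y))"
    by (simp only: matrix_transpose_mul[of "A ** X"] X(3) Y(3))
  also have "\<dots> = transpose (A ** Y)" using X(1) by (simp add: matrix_mul_assoc)
  finally have AX: "A ** X = A ** Y" using Y(3) by simp
  have "X ** A = (X ** A) ** (Y ** A)" using Y(1) by (metis matrix_mul_assoc)
  also have "\<dots> = transpose ((Y ** A) ** (X ** A))"
    by (simp only: matrix_transpose_mul[of "Y ** A"] X(4) Y(4))
  also have "(Y ** A) ** (X ** A) = Y ** A"
    using X(1) by (metis matrix_mul_assoc)
  finally have XA: "X ** A = Y ** A" using Y(4) by simp
  have "X = X ** A ** X" using X(2) by simp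
  also have "\<dots> = Y ** A ** X" using XA by simp
  also have "\<dots> = Y ** A ** Y" using AX by (simp flip: matrix_mul_assoc)
  finally show ?thesis using Y(2) by simp
qed

text \<open>For symmetric \<open>A\<close> this is the orthogonal projection onto the kernel; all computations with the
  pseudo-inverse go through it, because \<open>pinv A\<close> inverts \<open>A\<close> up to \<open>ker_proj A\<close>.\<close>

definition ker_proj :: "real^'p^'p \<Rightarrow> real^'p^'p" where
  "ker_proj A = mat 1 - A ** pinv A"

lemma symmetric_pinv:
  fixes A :: "real^'p^'p"
  assumes sym: "transpose A = A"
  shows "A ** pinv A = mat 1 - ker_proj A" "pinv A ** A = mat 1 - ker_proj A"
    "transpose (pinv A) = pinv A" "transpose (ker_proj A) = ker_proj A"
    "ker_proj A ** ker_proj A = ker_proj A" "A ** ker_proj A = 0" "ker_proj A ** A = 0"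
    "pinv A ** ker_proj A = 0" "ker_proj A ** pinv A = 0"
proof -
  obtain N where N: "transpose N = N" "A ** N = 0" "\<And>x. A *v x = 0 \<Longrightarrow> N *v x = x"
    by (rule orthogonal_projection_onto_kernel[of A]) blast
  have NA: "N ** A = 0"
    using N(1,2) sym by (metis matrix_transpose_mul transpose_distribs(5))
  have NN: "N ** N = N"
    unfolding matrix_eq
    by (metis N(2,3) matrix_vector_mul_assoc matrix_vector_mult_0)
  \<comment> \<open>\<open>A + N\<close> is invertible, and subtracting \<open>N\<close> from its inverse gives the pseudo-inverse.\<close>
  have inj: "x = 0" if "(A + N) *v x = 0" for x
  proof -
    have "N *v ((A + N) *v x) = N *v x"
      by (simp add: matrix_vector_mul_assoc mat_mult.add_right NA NN)
    then have Nx: "N *v x = 0" using that by simp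
    then have "A *v x = 0" using that by (simp add: matrix_vector_mult_add_rdistrib)
    then show "x = 0" using N(3) Nx by metis
  qed
  then obtain C where C: "C ** (A + N) = mat 1"
    by (metis matrix_left_invertible_ker)
  then have C': "(A + N) ** C = mat 1" by (simp add: matrix_left_right_inverse)
  have CN: "C ** N = N"
  proof -
    have "C ** N = C ** ((A + N) ** N)" by (simp add: mat_mult.add_left N(2) NN)
    then show ?thesis by (simp add: matrix_mul_assoc C)
  qed
  have NC: "N ** C = N"
  proof -
    have "N ** C = (N ** (A + N)) ** C" by (simp add: mat_mult.add_right NA NN)
    then show ?thesis by (simp add: C' flip: matrix_mul_assoc)
  qed
  define X where "X = C - N"
  have AX: "A ** X = mat 1 - N"
    using C' by (simp add: X_def mat_mult.diff_right mat_mult.add_left N(2) NC algebra_simps)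
  have XA: "X ** A = mat 1 - N"
    using C by (simp add: X_def mat_mult.diff_left mat_mult.add_right NA CN algebra_simps)
  have NX: "N ** X = 0" by (simp add: X_def mat_mult.diff_right NC NN)
  have XN: "X ** N = 0" by (simp add: X_def mat_mult.diff_left CN NN)
  have symC: "transpose C = C"
  proof -
    have "transpose C ** (A + N) = mat 1"
      using arg_cong[OF C', of transpose] by (simp add: transpose_distribs sym N(1))
    then show ?thesis
      by (metis C' matrix_mul_assoc matrix_mul_lid matrix_mul_rid)
  qed
  have penrose: "A ** X ** A = A \<and> X ** A ** X = X \<and>
     transpose (A ** X) = A ** X \<and> transpose (X ** A) = X ** A"
    by (simp add: AX XA matrix_distribs NA NX transpose_distribs N(1) del: matrix_transpose_mul)
  have pinv: "pinv A = X"
    unfolding pinv_def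
  proof (rule the_equality)
    fix Y assume "A ** Y ** A = A \<and> Y ** A ** Y = Y \<and>
      transpose (A ** Y) = A ** Y \<and> transpose (Y ** A) = Y ** A"
    then show "Y = X" using penrose by (intro pinv_unique[of A Y X]) auto
  qed (rule penrose)
  have k: "ker_proj A = N" by (simp add: ker_proj_def pinv AX)
  show "A ** pinv A = mat 1 - ker_proj A" "pinv A ** A = mat 1 - ker_proj A"
    "transpose (pinv A) = pinv A" "transpose (ker_proj A) = ker_proj A"
    "ker_proj A ** ker_proj A = ker_proj A" "A ** ker_proj A = 0" "ker_proj A ** A = 0"
    "pinv A ** ker_proj A = 0" "ker_proj A ** pinv A = 0"
    unfolding k pinv by (simp_all add: AX XA N NA NN NX XN) (simp add: X_def transpose_distribs symC N(1))
qed

lemma ker_proj_mult: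
  assumes "transpose A = A" "A ** M = 0"
  shows "ker_proj A ** M = M"
proof -
  have "ker_proj A ** M = M - pinv A ** (A ** M)"
    by (simp add: matrix_mul_assoc symmetric_pinv[OF assms(1)] matrix_distribs)
  then show ?thesis by (simp add: assms(2) mat_mult.zero_right)
qed

lemma ker_proj_mult_right:
  assumes "transpose A = A" "M ** A = 0"
  shows "M ** ker_proj A = M"
proof -
  have "M ** ker_proj A = M - (M ** A) ** pinv A"
    by (simp add: symmetric_pinv[OF assms(1)] matrix_distribs flip: matrix_mul_assoc)
  then show ?thesis by (simp add: assms(2) mat_mult.zero_left)
qed

lemma psd_pinv:
  assumes "A \<in> psd_mats"
  shows "pinv A \<in> psd_mats"
proof -
  note P = symmetric_pinv[OF psd_symD[OF assms]]
  have "transpose (pinv A) ** A ** pinv A = pinv A"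
    by (simp add: P matrix_distribs)
  then show ?thesis using psd_congruence[OF assms] by metis
qed

text \<open>A symmetric \<open>v\<close> points into the cone of positive semidefinite matrices at \<open>S\<close> as soon as its
  compression to \<open>ker S\<close> is positive semidefinite, but the line \<open>S + s v\<close> itself may leave the cone
  because of the blocks of \<open>v\<close> between \<open>ker S\<close> and its complement.  The congruence
  \<open>(1 + s X)\<^sup>T S (1 + s X)\<close> has prescribed first-order term \<open>X\<^sup>T S + S X\<close>, and \<open>X\<close> is chosen so that this
  term is \<open>v\<close> without its \<open>ker S\<close> block, which is then added separately.  The last
  property says that the correction respects complementarity.  The lemma is used in the primal
  cone at \<open>- \<phi> xb\<close> and in the dual cone at \<open>yb\<close>.\<close>

lemma psd_second_order_curve:
  fixes S v :: "real^'p^'p"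
  assumes S: "S \<in> psd_mats" and v: "transpose v = v" and "ker_proj S ** v ** ker_proj S \<in> psd_mats"
  obtains M where "\<And>s. 0 \<le> s \<Longrightarrow> S + s *\<^sub>R v + s\<^sup>2 *\<^sub>R M \<in> psd_mats"
    "\<And>y :: real^'p^'p. y ** S = 0 \<Longrightarrow> y ** v = 0 \<Longrightarrow> y ** M = 0"
proof -
  note P = symmetric_pinv[OF psd_symD[OF S]]
  note sS = psd_symD[OF S]
  define N where "N = ker_proj S"
  define X where "X = (1/2) *\<^sub>R (pinv S ** v ** (mat 1 + N))"
  define M where "M = transpose X ** S ** X"
  have tX: "transpose X = (1/2) *\<^sub>R ((mat 1 + N) ** v ** pinv S)"
    by (simp add: X_def transpose_distribs P N_def v matrix_mul_assoc)
  have XS: "transpose X ** S + S ** X = v - N ** v ** N"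
  proof -
    have "transpose X ** S = (1/2) *\<^sub>R ((mat 1 + N) ** v ** (mat 1 - N))"
      unfolding tX by (simp add: matrix_distribs N_def P flip: matrix_mul_assoc)
    moreover have "S ** X = (1/2) *\<^sub>R ((mat 1 - N) ** v ** (mat 1 + N))"
      unfolding X_def by (simp add: mat_mult.scaleR_right matrix_mul_assoc P N_def)
    ultimately have "transpose X ** S + S ** X
        = (1/2) *\<^sub>R ((mat 1 + N) ** v ** (mat 1 - N) + (mat 1 - N) ** v ** (mat 1 + N))"
      by (simp add: scaleR_add_right)
    also have "\<dots> = (1/2) *\<^sub>R (2 *\<^sub>R (v - N ** v ** N))"
      unfolding scaleR_2 by (simp add: matrix_distribs)
    finally show ?thesis by simp
  qed
  show ?thesis
  proof
    show "S + s *\<^sub>R v + s\<^sup>2 *\<^sub>R M \<in> psd_mats" if "0 \<le> s" for s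
    proof -
      have "transpose (mat 1 + s *\<^sub>R X) ** S ** (mat 1 + s *\<^sub>R X) + s *\<^sub>R (N ** v ** N)
         = S + s *\<^sub>R (transpose X ** S + S ** X) + s\<^sup>2 *\<^sub>R M + s *\<^sub>R (N ** v ** N)"
        by (simp add: transpose_distribs matrix_distribs M_def power2_eq_square algebra_simps)
      also have "\<dots> = S + s *\<^sub>R v + s\<^sup>2 *\<^sub>R M"
        unfolding XS by (simp add: algebra_simps)
      finally show ?thesis
        using psd_add[OF psd_congruence[OF S, of "mat 1 + s *\<^sub>R X"] psd_scaleR[OF that assms(3)]]
        by (simp add: N_def)
    qed
    show "y ** M = 0" if "y ** S = 0" "y ** v = 0" for y :: "real^'p^'p"
    proof -
      have "y ** N = y"
        using ker_proj_mult_right[OF sS that(1)] by (simp add: N_def)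
      then have "y ** transpose X = 0"
        unfolding tX by (simp add: matrix_mul_assoc matrix_distribs that(2))
      then show ?thesis by (simp add: M_def matrix_mul_assoc mat_mult.zero_left)
    qed
  qed
qed

section \<open>Complementary pairs of positive semidefinite matrices\<close>

locale complementary_psd =
  fixes S y :: "real^'p^'p"
  assumes psd_S: "S \<in> psd_mats" and psd_y: "y \<in> psd_mats" and Sy: "S ** y = 0"
begin

abbreviation "N \<equiv> ker_proj S"

text \<open>The projection onto \<open>ker S \<inter> ker y\<close>, the block on which strict complementarity fails.  Since
  \<open>S ** y = 0\<close>, the space is the orthogonal sum of \<open>range y\<close>, \<open>range S\<close> and this block.\<close>

definition "biactive = ker_proj S ** ker_proj y"

lemma sym_S: "transpose S = S" and sym_y: "transpose y = y"
  using psd_S psd_y by (auto simp: psd_symD)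

lemma yS: "y ** S = 0"
  using arg_cong[OF Sy, of transpose] by (simp add: transpose_distribs sym_S sym_y)

lemma inner_zero: "y \<bullet> S = 0"
  using trace_inner[of y S] by (simp add: sym_y yS trace_def)

lemmas pinv_S = symmetric_pinv[OF sym_S] and pinv_y = symmetric_pinv[OF sym_y]

lemma Ny: "N ** y = y" and yN: "y ** N = y"
  using ker_proj_mult[OF sym_S Sy] ker_proj_mult_right[OF sym_S yS] by auto

lemma biactive_eq: "biactive = N + ker_proj y - mat 1"
proof -
  have "N ** (mat 1 - ker_proj y) = mat 1 - ker_proj y"
    by (simp flip: pinv_y(1) add: matrix_mul_assoc Ny)
  then show ?thesis
    by (simp add: biactive_def matrix_distribs algebra_simps)
qed

lemma biactive_eq': "biactive = ker_proj y ** N"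
proof -
  have "(mat 1 - ker_proj y) ** N = mat 1 - ker_proj y"
    unfolding pinv_y(2)[symmetric] by (simp add: yN flip: matrix_mul_assoc)
  then show ?thesis
    by (simp add: biactive_eq matrix_distribs algebra_simps)
qed

lemma biactive_sym: "transpose biactive = biactive"
  by (simp add: biactive_eq transpose_distribs pinv_S pinv_y)

lemma biactive_annihilates: "biactive ** y = 0" "y ** biactive = 0" "biactive ** S = 0" "S ** biactive = 0"
  unfolding biactive_eq by (simp_all add: matrix_distribs Ny yN yS Sy pinv_S pinv_y
     ker_proj_mult[OF sym_y yS] ker_proj_mult_right[OF sym_y Sy])

lemma biactive_idem: "biactive ** biactive = biactive"
  using biactive_annihilates unfolding biactive_def
  by (metis (no_types) biactive_def biactive_eq' matrix_mul_assoc pinv_S(5) pinv_y(5))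

text \<open>The compression of \<open>v\<close> to \<open>ker S\<close> is nonpositive and orthogonal to \<open>y \<ge> 0\<close>, so its product with
  \<open>y\<close> vanishes.\<close>

lemma critical_direction:
  assumes v: "transpose v = v" and nsd: "- (N ** v ** N) \<in> psd_mats" and "y \<bullet> v = 0"
  shows "y ** v ** N = 0"
proof -
  have "y \<bullet> (- (N ** v ** N)) = - ((N ** y ** N) \<bullet> v)"
    by (simp add: inner_congruence pinv_S)
  also have "\<dots> = 0" by (simp add: Ny yN assms(3))
  finally have "y ** (- (N ** v ** N)) = 0"
    using psd_inner_zero[OF psd_y nsd] by blast
  then show ?thesis by (simp add: matrix_distribs matrix_mul_assoc yN)
qed

text \<open>By \<open>critical_direction\<close> the compression of a critical \<open>v\<close> to \<open>ker S\<close> lives on the biactive block,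
  while \<open>E\<close> lives on \<open>ker S\<close>; so \<open>E \<bullet> v\<close> only sees the biactive blocks, which have opposite signs.\<close>

lemma critical_polar:
  assumes E: "E ** S = 0" "transpose E = E" "biactive ** E ** biactive \<in> psd_mats"
    and v: "transpose v = v" "- (N ** v ** N) \<in> psd_mats" "y \<bullet> v = 0"
  shows "E \<bullet> v \<le> 0"
proof -
  define R where "R = mat 1 - ker_proj y"
  have "y ** v ** N = 0" by (rule critical_direction[OF v])
  then have 1: "R ** v ** N = 0"
    unfolding R_def pinv_y(2)[symmetric] by (simp add: mat_mult.zero_right flip: matrix_mul_assoc)
  then have 2: "N ** v ** R = 0"
  proof -
    have "transpose (R ** v ** N) = 0" unfolding 1 by (simp add: transpose_distribs)
    then show ?thesis
      by (simp add: transpose_distribs v pinv_S pinv_y R_def matrix_mul_assoc)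
  qed
  have NR: "N ** R = R"
    unfolding R_def pinv_y(1)[symmetric] by (simp add: matrix_mul_assoc Ny)
  have 3: "R ** v ** R = 0"
    using arg_cong[OF 1, of "\<lambda>A. A ** R"] by (simp add: NR mat_mult.zero_left flip: matrix_mul_assoc)
  have B: "biactive = N - R" by (simp add: biactive_eq R_def)
  have BvB: "biactive ** v ** biactive = N ** v ** N"
    by (simp add: B matrix_distribs 1 2 3)
  have EN: "E ** N = E" by (rule ker_proj_mult_right[OF sym_S E(1)])
  then have NE: "N ** E = E"
    by (metis E(2) matrix_transpose_mul pinv_S(4))
  have "E \<bullet> v = (N ** E ** N) \<bullet> v" by (simp add: NE EN)
  also have "\<dots> = E \<bullet> (N ** v ** N)"
    by (simp add: inner_congruence pinv_S)
  also have "\<dots> = E \<bullet> (biactive ** (biactive ** v ** biactive) ** biactive)"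
    by (simp add: BvB[symmetric] matrix_mul_assoc biactive_idem biactive_idem[THEN mult_assoc_cong])
  also have "\<dots> = (biactive ** E ** biactive) \<bullet> (biactive ** v ** biactive)"
    by (simp add: inner_congruence biactive_sym)
  also have "\<dots> \<le> 0"
    using psd_inner_nonneg[OF E(3) v(2)] by (simp add: BvB)
  finally show ?thesis .
qed

text \<open>Split \<open>E \<bullet> H\<close> along \<open>range S\<close>, the biactive block and \<open>range y\<close>.  The equation \<open>E ** S = y ** H\<close>
  determines \<open>E\<close> on \<open>range S\<close> as \<open>y ** H ** pinv S\<close>, so that part equals \<open>y \<bullet> (H ** pinv S ** H)\<close>.  The same
  equation annihilates the blocks of \<open>H\<close> between \<open>range y\<close> and \<open>ker S\<close>, so by symmetry the part on
  \<open>range y\<close> has the same value.  The biactive part is zero by \<open>BEHB\<close>.\<close>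

lemma graphical_derivative_curvature:
  assumes E: "transpose E = E" and H: "transpose H = H"
    and ES: "E ** S = y ** H" and BEHB: "biactive ** E ** H ** biactive = 0"
  shows "E \<bullet> H = 2 * (y \<bullet> (H ** pinv S ** H))"
proof -
  define R where "R = mat 1 - ker_proj y"
  define Q where "Q = mat 1 - N"
  have tR: "transpose R = R" and tQ: "transpose Q = Q"
    by (simp_all add: R_def Q_def transpose_distribs pinv_S pinv_y)
  have one: "E = E ** Q + E ** biactive + E ** R"
    by (simp add: Q_def R_def biactive_eq matrix_distribs)
  have EQ: "E ** Q = y ** H ** pinv S"
    unfolding Q_def pinv_S(1)[symmetric] by (simp add: matrix_mul_assoc ES)
  have Q: "(E ** Q) \<bullet> H = y \<bullet> (H ** pinv S ** H)"
    unfolding EQ by (simp add: inner_matrix_mult_right transpose_distribs pinv_S H flip: matrix_mul_assoc)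
  have "(E ** biactive) \<bullet> H = biactive \<bullet> (E ** H)"
    by (simp add: inner_matrix_mult_left E)
  also have "\<dots> = (biactive ** biactive ** biactive) \<bullet> (E ** H)"
    by (simp add: biactive_idem)
  also have "\<dots> = biactive \<bullet> (biactive ** E ** H ** biactive)"
    by (simp add: inner_congruence biactive_sym matrix_mul_assoc)
  finally have B: "(E ** biactive) \<bullet> H = 0" by (simp add: BEHB)
  have "y ** H ** N = E ** (S ** N)" by (simp add: ES matrix_mul_assoc)
  then have yHN: "y ** H ** N = 0" by (simp add: pinv_S mat_mult.zero_right)
  then have RHN: "R ** H ** N = 0"
    unfolding R_def pinv_y(2)[symmetric] by (simp add: mat_mult.zero_right flip: matrix_mul_assoc)
  then have HR: "H ** R = Q ** H ** R"
  proof -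
    have "transpose (R ** H ** N) = 0" unfolding RHN by (simp add: transpose_distribs)
    then have "N ** H ** R = 0"
      by (simp add: transpose_distribs H pinv_S tR matrix_mul_assoc)
    then show ?thesis by (simp add: Q_def mat_mult.diff_left matrix_mul_lid)
  qed
  have QE: "Q ** E = pinv S ** H ** y"
    using arg_cong[OF EQ, of transpose]
    by (simp add: transpose_distribs E H sym_y pinv_S Q_def matrix_mul_assoc)
  have yR: "y ** R = y" by (simp add: R_def matrix_distribs pinv_y)
  have "(E ** R) \<bullet> H = E \<bullet> (Q ** H ** R)"
    by (simp add: inner_matrix_mult_right HR[symmetric] tR)
  also have "\<dots> = (Q ** E ** R) \<bullet> H"
    by (simp add: inner_matrix_mult_right[of "Q ** E"] inner_matrix_mult_left[of Q] tQ tR matrix_mul_assoc)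
  also have "\<dots> = (pinv S ** H ** y) \<bullet> H"
    by (simp add: QE yR flip: matrix_mul_assoc)
  also have "\<dots> = y \<bullet> (H ** pinv S ** H)"
    by (simp add: inner_matrix_mult_left transpose_distribs pinv_S H flip: matrix_mul_assoc)
  finally have R: "(E ** R) \<bullet> H = y \<bullet> (H ** pinv S ** H)" .
  have "E \<bullet> H = (E ** Q) \<bullet> H + (E ** biactive) \<bullet> H + (E ** R) \<bullet> H"
    by (subst one) (simp add: inner_add_left)
  then show ?thesis using Q B R by simp
qed

text \<open>Zero curvature means that \<open>y\<close> is orthogonal to the positive semidefinite \<open>H ** pinv S ** H\<close>, which
  gives \<open>y ** H ** pinv S = 0\<close>; this kills the part of \<open>y ** H\<close> on \<open>range S\<close>, and
  \<open>critical_direction\<close> kills the part on \<open>ker S\<close>.\<close>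

lemma zero_curvature:
  assumes H: "transpose H = H" "- (N ** H ** N) \<in> psd_mats" "y \<bullet> H = 0"
    and curv: "y \<bullet> (H ** pinv S ** H) = 0"
  shows "y ** H = 0"
proof -
  define D where "D = pinv S"
  have D: "D \<in> psd_mats" unfolding D_def by (rule psd_pinv[OF psd_S])
  have "H ** D ** H \<in> psd_mats" using psd_congruence[OF D, of H] by (simp add: H(1))
  then have 0: "y ** (H ** D ** H) = 0"
    using psd_inner_zero[OF psd_y] curv by (simp add: D_def)
  have "D *v (H *v (y *v x)) = 0" for x
  proof (rule psd_quadratic_zero[OF D])
    have "(H *v (y *v x)) \<bullet> (D *v (H *v (y *v x))) = x \<bullet> ((y ** (H ** D ** H) ** y) *v x)"
      unfolding inner_mult_vec H(1) sym_y by (simp only: matrix_vector_mul_assoc matrix_mul_assoc)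
    then show "(H *v (y *v x)) \<bullet> (D *v (H *v (y *v x))) = 0"
      by (simp add: 0 mat_mult.zero_left)
  qed
  then have "D ** H ** y = 0"
    unfolding zero_matrix_iff by (simp add: matrix_vector_mul_assoc matrix_mul_assoc)
  then have "transpose (D ** H ** y) = 0" by (simp add: transpose_distribs)
  then have yHD: "y ** H ** D = 0"
    by (simp add: transpose_distribs D_def pinv_S H(1) sym_y matrix_mul_assoc)
  have "y ** H = y ** H ** N + y ** H ** (D ** S)"
    by (simp add: D_def pinv_S matrix_distribs)
  also have "y ** H ** (D ** S) = 0" by (simp add: matrix_mul_assoc yHD mat_mult.zero_left)
  finally show ?thesis using critical_direction[OF H] by simp
qed

end

section \<open>Radial cones and polyhedra\<close>

abbreviation radial_cone :: "'a::euclidean_space set \<Rightarrow> 'a \<Rightarrow> 'a set" where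
  "radial_cone C u \<equiv> cone hull ((\<lambda>k. k - u) ` C)"

lemma convex_step:
  assumes "convex C" "u \<in> C" "u + s *\<^sub>R x \<in> C" "0 \<le> t" "t \<le> s"
  shows "u + t *\<^sub>R x \<in> C"
proof (cases "s = 0")
  case False
  have "(1 - t/s) *\<^sub>R u + (t/s) *\<^sub>R (u + s *\<^sub>R x) \<in> C"
    using assms False by (intro convexD_alt[OF assms(1-3)]) auto
  also have "(1 - t/s) *\<^sub>R u + (t/s) *\<^sub>R (u + s *\<^sub>R x) = u + t *\<^sub>R x"
    using False by (simp add: algebra_simps)
  finally show ?thesis .
qed (use assms in auto)

lemma radial_cone_iff:
  assumes "u \<in> C"
  shows "x \<in> radial_cone C u \<longleftrightarrow> (\<exists>s>0. u + s *\<^sub>R x \<in> C)"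
proof
  assume "x \<in> radial_cone C u"
  then obtain c k where ck: "x = c *\<^sub>R (k - u)" "c \<ge> 0" "k \<in> C"
    unfolding cone_hull_expl by blast
  show "\<exists>s>0. u + s *\<^sub>R x \<in> C"
  proof (cases "c = 0")
    case True
    then show ?thesis using assms ck by (intro exI[of _ 1]) auto
  next
    case False
    then show ?thesis using ck by (intro exI[of _ "1/c"]) auto
  qed
next
  assume "\<exists>s>0. u + s *\<^sub>R x \<in> C"
  then obtain s where s: "s > 0" "u + s *\<^sub>R x \<in> C" by blast
  have "x = (1/s) *\<^sub>R ((u + s *\<^sub>R x) - u)" using s by simp
  moreover have "\<dots> \<in> radial_cone C u"
    using s by (intro mem_cone_hull imageI) auto
  ultimately show "x \<in> radial_cone C u" by simp
qed

lemma radial_cone_Times: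
  assumes "convex A" "convex B" "a \<in> A" "b \<in> B"
  shows "radial_cone (A \<times> B) (a, b) = radial_cone A a \<times> radial_cone B b"
proof -
  have "(\<exists>s>0. (a, b) + s *\<^sub>R (x, y) \<in> A \<times> B) \<longleftrightarrow>
    (\<exists>s>0. a + s *\<^sub>R x \<in> A) \<and> (\<exists>s>0. b + s *\<^sub>R y \<in> B)" for x y
  proof safe
    fix s t :: real assume st: "s > 0" "a + s *\<^sub>R x \<in> A" "t > 0" "b + t *\<^sub>R y \<in> B"
    then show "\<exists>s>0. (a, b) + s *\<^sub>R (x, y) \<in> A \<times> B"
      using convex_step[OF assms(1,3) st(2), of "min s t"] convex_step[OF assms(2,4) st(4), of "min s t"]
      by (intro exI[of _ "min s t"]) auto
  qed auto
  then show ?thesis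
    using assms by (auto simp: radial_cone_iff simp del: scaleR_Pair)
qed

text \<open>Intersecting with a box around \<open>v\<close> gives a polytope, and a polytope has finitely many vertices.  They
  generate all directions from \<open>v\<close> into \<open>P\<close>, so the two facts below reduce to finite sets of points.\<close>

lemma polyhedron_local_vertices:
  fixes P :: "'a::euclidean_space set"
  assumes "polyhedron P" "v \<in> P"
  obtains V where "finite V" "V \<subseteq> P" "\<And>p. p \<in> P \<Longrightarrow> \<exists>s>0. v + s *\<^sub>R (p - v) \<in> convex hull V"
proof -
  define W where "W = P \<inter> cbox (v - One) (v + One)"
  have "polytope W"
    unfolding polytope_eq_bounded_polyhedron W_def
    using assms by (auto intro: bounded_subset[OF bounded_cbox])
  then obtain V where V: "finite V" "W = convex hull V"
    unfolding polytope_def by blast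
  have step: "\<exists>s>0. v + s *\<^sub>R (p - v) \<in> W" if "p \<in> P" for p
  proof (intro exI conjI)
    define s where "s = 1 / (1 + norm (p - v))"
    show "s > 0" unfolding s_def by (intro divide_pos_pos add_pos_nonneg) auto
    have "s \<le> 1" by (simp add: s_def add_pos_nonneg)
    have "v + s *\<^sub>R (p - v) \<in> P"
      by (rule convex_step[OF polyhedron_imp_convex[OF assms(1)], of v 1])
        (use that assms(2) \<open>s > 0\<close> \<open>s \<le> 1\<close> in simp_all)
    moreover have "\<bar>s * ((p - v) \<bullet> b)\<bar> \<le> 1" if "b \<in> Basis" for b
    proof -
      have "\<bar>(p - v) \<bullet> b\<bar> \<le> 1 + norm (p - v)"
        using Basis_le_norm[OF that, of "p - v"] by simp
      then show ?thesis
        by (simp add: s_def divide_le_eq abs_mult)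
    qed
    then have "v + s *\<^sub>R (p - v) \<in> cbox (v - One) (v + One)"
      by (simp add: mem_box inner_add_left inner_diff_left[of v One] abs_le_iff)
    ultimately show "v + s *\<^sub>R (p - v) \<in> W"
      by (simp add: W_def)
  qed
  have "V \<subseteq> W" unfolding V(2) by (rule hull_subset)
  also have "\<dots> \<subseteq> P" by (simp add: W_def)
  finally show thesis
    by (rule that[OF V(1)]) (rule step[unfolded V(2)])
qed

lemma closed_radial_cone_polyhedron:
  fixes P :: "'a::euclidean_space set"
  assumes "polyhedron P" "v \<in> P"
  shows "closed (radial_cone P v)"
proof -
  obtain V where V: "finite V" "V \<subseteq> P" "\<And>p. p \<in> P \<Longrightarrow> \<exists>s>0. v + s *\<^sub>R (p - v) \<in> convex hull V"
    by (rule polyhedron_local_vertices[OF assms]) blast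
  define U where "U = (\<lambda>p. - v + p) ` V"
  have hullU: "convex hull U = (\<lambda>p. - v + p) ` (convex hull V)"
    unfolding U_def by (rule convex_hull_translation)
  have "V \<noteq> {}" using V(3)[OF assms(2)] by auto
  then have U: "convex_cone hull U = (\<Union>x \<in> convex hull U. \<Union>c\<in>{0..}. {c *\<^sub>R x})"
    by (intro convex_cone_hull_convex_hull_nonempty) (auto simp: U_def)
  have "radial_cone P v = convex_cone hull U"
  proof
    show "radial_cone P v \<subseteq> convex_cone hull U"
    proof
      fix x assume "x \<in> radial_cone P v"
      then obtain c p where x: "x = c *\<^sub>R (p - v)" "c \<ge> 0" "p \<in> P"
        unfolding cone_hull_expl by blast
      obtain s where s: "s > 0" "v + s *\<^sub>R (p - v) \<in> convex hull V" using V(3) x(3) by blast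
      then have "s *\<^sub>R (p - v) \<in> convex hull U"
        unfolding hullU by (force simp: image_iff)
      moreover have "x = (c / s) *\<^sub>R (s *\<^sub>R (p - v))" using x s by simp
      ultimately show "x \<in> convex_cone hull U"
        unfolding U using x(2) s(1) by (auto intro!: bexI[of _ "s *\<^sub>R (p - v)"] bexI[of _ "c / s"])
    qed
    have "convex hull V \<subseteq> P"
      using V(2) polyhedron_imp_convex[OF assms(1)] by (simp add: hull_minimal)
    then show "convex_cone hull U \<subseteq> radial_cone P v"
      unfolding U hullU by (auto intro!: mem_cone_hull)
  qed
  then show ?thesis
    using closed_convex_cone_hull[of U] V(1) by (simp add: U_def)
qed

text \<open>For a vertex \<open>p\<close> with \<open>z \<bullet> (p - v) < 0\<close> a small perturbation of \<open>z\<close> does no harm, and for one with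
  \<open>z \<bullet> (p - v) = 0\<close> the hypothesis on \<open>d\<close> applies.  There are only finitely many vertices, so one step
  length works for all of them; for a general convex set this fails.\<close>

lemma polyhedron_normal_perturbation:
  fixes P :: "'a::euclidean_space set"
  assumes "polyhedron P" "v \<in> P" and z: "\<And>p. p \<in> P \<Longrightarrow> z \<bullet> (p - v) \<le> 0"
    and d: "\<And>k. k \<in> radial_cone P v \<Longrightarrow> z \<bullet> k = 0 \<Longrightarrow> d \<bullet> k \<le> 0"
  shows "\<forall>\<^sub>F t in at_right 0. \<forall>p\<in>P. (z + t *\<^sub>R d) \<bullet> (p - v) \<le> 0"
proof -
  obtain V where V: "finite V" "V \<subseteq> P" "\<And>p. p \<in> P \<Longrightarrow> \<exists>s>0. v + s *\<^sub>R (p - v) \<in> convex hull V"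
    by (rule polyhedron_local_vertices[OF assms(1,2)]) blast
  have "\<forall>\<^sub>F t in at_right 0. (z + t *\<^sub>R d) \<bullet> (p - v) \<le> 0" if p: "p \<in> V" for p
  proof (cases "z \<bullet> (p - v) = 0")
    case True
    have "1 *\<^sub>R (p - v) \<in> radial_cone P v" using p V(2) by (intro mem_cone_hull) auto
    then have "d \<bullet> (p - v) \<le> 0" using d[of "p - v"] True by simp
    then show ?thesis
      by (intro eventually_mono[OF eventually_at_right_less[of 0]])
        (simp add: inner_add_left True mult_le_0_iff)
  next
    case False
    then have "z \<bullet> (p - v) < 0" using z[of p] p V(2) by (auto simp: order_less_le)
    moreover have "((\<lambda>t. (z + t *\<^sub>R d) \<bullet> (p - v)) \<longlongrightarrow> (z + 0 *\<^sub>R d) \<bullet> (p - v)) (at_right 0)"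
      by (intro tendsto_intros)
    ultimately have "\<forall>\<^sub>F t in at_right 0. (z + t *\<^sub>R d) \<bullet> (p - v) < 0"
      by (intro order_tendstoD(2)) auto
    then show ?thesis by (rule eventually_mono) simp
  qed
  then have "\<forall>\<^sub>F t in at_right 0. \<forall>p\<in>V. (z + t *\<^sub>R d) \<bullet> (p - v) \<le> 0"
    using V(1) by (simp add: eventually_ball_finite)
  then show ?thesis
  proof (rule eventually_mono)
    fix t assume t: "\<forall>p\<in>V. (z + t *\<^sub>R d) \<bullet> (p - v) \<le> 0"
    define w where "w = z + t *\<^sub>R d"
    have "convex hull V \<subseteq> {x. w \<bullet> x \<le> w \<bullet> v}"
      using t by (intro hull_minimal convex_halfspace_le) (auto simp: w_def inner_diff_right)
    then have "w \<bullet> (p - v) \<le> 0" if p: "p \<in> P" for p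
    proof -
      obtain s where s: "s > 0" "v + s *\<^sub>R (p - v) \<in> convex hull V" using V(3)[OF p] by blast
      then have "w \<bullet> (v + s *\<^sub>R (p - v)) \<le> w \<bullet> v"
        using \<open>convex hull V \<subseteq> _\<close> by blast
      then show ?thesis using s(1) by (simp add: inner_add_right mult_le_0_iff)
    qed
    then show "\<forall>p\<in>P. (z + t *\<^sub>R d) \<bullet> (p - v) \<le> 0" unfolding w_def by blast
  qed
qed

section \<open>Normal and tangent cones of the constraint set\<close>

lemma closest_point_add_eq_iff:
  fixes K :: "'a::euclidean_space set"
  assumes "convex K" "closed K" "K \<noteq> {}"
  shows "closest_point K (u + w) = u \<longleftrightarrow> u \<in> K \<and> (\<forall>k\<in>K. w \<bullet> (k - u) \<le> 0)"
proof
  assume eq: "closest_point K (u + w) = u"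
  then show "u \<in> K \<and> (\<forall>k\<in>K. w \<bullet> (k - u) \<le> 0)"
    using closest_point_in_set[OF assms(2,3), of "u + w"] closest_point_dot[OF assms(1,2), of _ "u + w"]
    by auto
next
  assume R: "u \<in> K \<and> (\<forall>k\<in>K. w \<bullet> (k - u) \<le> 0)"
  have "dist (u + w) u \<le> dist (u + w) k" if "k \<in> K" for k
  proof -
    define e where "e = k - u"
    have "w \<bullet> e \<le> 0" using R that by (simp add: e_def)
    moreover have "(w - e) \<bullet> (w - e) = w \<bullet> w - 2 * (w \<bullet> e) + e \<bullet> e"
      by (simp add: inner_diff_left inner_diff_right inner_commute[of e w])
    ultimately have "w \<bullet> w \<le> (w - e) \<bullet> (w - e)"
      using inner_ge_zero[of e] by linarith
    moreover have "dist (u + w) k = norm (w - e)" by (simp add: e_def dist_norm algebra_simps)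
    moreover have "dist (u + w) u = norm w" by (simp add: dist_norm)
    ultimately show ?thesis by (simp only: norm_le)
  qed
  then show "closest_point K (u + w) = u"
    using R by (intro closest_point_unique[OF assms(1,2), symmetric]) auto
qed

lemma convex_psd_mats: "convex psd_mats"
  by (auto simp: convex_def intro!: psd_add psd_scaleR)

lemma convex_nsd_mats: "convex nsd_mats"
  unfolding nsd_mats_def by (rule convex_negations[OF convex_psd_mats])

lemma closed_nsd_mats: "closed nsd_mats"
  unfolding nsd_mats_def by (rule closed_negations[OF closed_psd_mats])

text \<open>The base point is written with \<open>- S\<close> so that both members of the resulting complementary pair are
  positive semidefinite.  Normality is tested against \<open>0\<close>, \<open>- 2 S\<close> and \<open>- S - outer x\<close>.\<close>

lemma normal_cone_Kset_iff:
  fixes S y :: "real^'p^'p" and z v :: "'z::euclidean_space"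
  shows "(y, z) \<in> normal_cone Yspace (Kset P) (- S, v) \<longleftrightarrow>
    complementary_psd S y \<and> v \<in> P \<and> (\<forall>p\<in>P. z \<bullet> (p - v) \<le> 0)"
    (is "?L \<longleftrightarrow> ?R")
proof
  assume ?L
  then have y: "transpose y = y" and S: "S \<in> psd_mats" and v: "v \<in> P"
    and N: "\<And>k p. k \<in> nsd_mats \<Longrightarrow> p \<in> P \<Longrightarrow> y \<bullet> (k + S) + z \<bullet> (p - v) \<le> 0"
    by (auto simp: normal_cone_def Yspace_def Kset_def sym_mats_def nsd_mats_iff)
  have Ny: "y \<bullet> (S - k) \<le> 0" if "k \<in> psd_mats" for k
    using N[of "- k" v] v that by (simp add: nsd_mats_iff)
  have Sy: "y \<bullet> S = 0"
    using Ny[OF psd_zero] Ny[OF psd_scaleR[OF _ S, of 2]] by (simp add: scaleR_2)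
  have "0 \<le> x \<bullet> (y *v x)" for x
    using Ny[OF psd_add[OF S psd_outer[of x]]] outer_inner[of x y] by (simp add: inner_commute)
  then have y: "y \<in> psd_mats" using y by (simp add: psd_mats_iff)
  have "S ** y = 0" using psd_inner_zero[OF S y] Sy by (simp add: inner_commute)
  then show ?R
    using S y v N[of "- S"] by (auto simp: complementary_psd_def nsd_mats_iff)
next
  assume R: ?R
  then interpret complementary_psd S y by simp
  have "y \<bullet> (k + S) + z \<bullet> (p - v) \<le> 0" if "k \<in> nsd_mats" "p \<in> P" for k p
  proof -
    have "y \<bullet> k \<le> 0"
      using psd_inner_nonneg[OF psd_y, of "- k"] that(1) by (simp add: nsd_mats_iff)
    moreover have "z \<bullet> (p - v) \<le> 0" using R that(2) by blast
    ultimately show ?thesis by (simp add: inner_add_right inner_zero)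
  qed
  then show ?L
    using R psd_S sym_y by (auto simp: normal_cone_def Yspace_def Kset_def sym_mats_def nsd_mats_iff)
qed

text \<open>Feasible directions satisfy the closed condition on the right.  Conversely a matrix satisfying it is
  the limit of the feasible directions \<open>h - s M\<close> supplied by \<open>psd_second_order_curve\<close>.\<close>

lemma tangent_cone_nsd:
  fixes S :: "real^'p^'p"
  assumes S: "S \<in> psd_mats"
  shows "closure (radial_cone nsd_mats (- S)) = {h. transpose h = h \<and> - (ker_proj S ** h ** ker_proj S) \<in> psd_mats}"
    (is "_ = ?T")
proof
  note P = symmetric_pinv[OF psd_symD[OF S]]
  have mS: "- S \<in> nsd_mats" using S by (simp add: nsd_mats_iff)
  have "closed ?T"
  proof -
    have "?T = {h. transpose h = h} \<inter> (\<lambda>h. - (ker_proj S ** h ** ker_proj S)) -` psd_mats" by auto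
    moreover have "closed {h :: real^'p^'p. transpose h = h}"
      by (intro closed_Collect_eq linear_continuous_on bounded_linear_transpose continuous_on_id)
    moreover have "closed ((\<lambda>h. - (ker_proj S ** h ** ker_proj S)) -` psd_mats)"
      by (intro continuous_closed_vimage closed_psd_mats continuous_intros
          bounded_bilinear.continuous[OF bounded_bilinear_matrix_mult])
    ultimately show ?thesis by (simp only: closed_Int)
  qed
  moreover have "radial_cone nsd_mats (- S) \<subseteq> ?T"
  proof
    fix h assume "h \<in> radial_cone nsd_mats (- S)"
    then obtain c k where h: "h = c *\<^sub>R (k + S)" "c \<ge> 0" "- k \<in> psd_mats"
      unfolding cone_hull_expl by (auto simp: nsd_mats_iff)
    have "- (ker_proj S ** h ** ker_proj S) = c *\<^sub>R (transpose (ker_proj S) ** (- k) ** ker_proj S)"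
      by (simp add: h(1) matrix_distribs P)
    moreover have "transpose (- k) = - k" by (rule psd_symD[OF h(3)])
    then have "transpose h = h"
      by (simp add: h(1) transpose_distribs psd_symD[OF S])
    ultimately show "h \<in> ?T"
      using psd_scaleR[OF h(2) psd_congruence[OF h(3)]] by simp
  qed
  ultimately show "closure (radial_cone nsd_mats (- S)) \<subseteq> ?T"
    by (simp add: closure_minimal)
  show "?T \<subseteq> closure (radial_cone nsd_mats (- S))"
  proof
    fix h assume "h \<in> ?T"
    then have h: "transpose (- h) = - h" "ker_proj S ** (- h) ** ker_proj S \<in> psd_mats"
      by (auto simp: transpose_distribs matrix_distribs)
    obtain M where M: "\<And>s. 0 \<le> s \<Longrightarrow> S + s *\<^sub>R (- h) + s\<^sup>2 *\<^sub>R M \<in> psd_mats"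
      by (rule psd_second_order_curve[OF S h]) blast
    have "h - s *\<^sub>R M \<in> radial_cone nsd_mats (- S)" if "s > 0" for s
    proof -
      have "- (- S + s *\<^sub>R (h - s *\<^sub>R M)) = S + s *\<^sub>R (- h) + s\<^sup>2 *\<^sub>R M"
        by (simp add: algebra_simps power2_eq_square)
      then show ?thesis
        unfolding radial_cone_iff[OF mS] using M[of s] that
        by (intro exI[of _ s]) (simp only: nsd_mats_iff)
    qed
    then have "\<forall>\<^sub>F s in at_right 0. h - s *\<^sub>R M \<in> radial_cone nsd_mats (- S)"
      by (intro eventually_mono[OF eventually_at_right_less])
    moreover have "((\<lambda>s. h - s *\<^sub>R M) \<longlongrightarrow> h - 0 *\<^sub>R M) (at_right 0)"
      by (intro tendsto_intros)
    ultimately show "h \<in> closure (radial_cone nsd_mats (- S))"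
      using Lim_in_closed_set[OF closed_closure, of "\<lambda>s. h - s *\<^sub>R M"]
      by (smt (verit) closure_subset eventually_mono scaleR_zero_left subsetD trivial_limit_at_right_real diff_zero)
  qed
qed

lemma tangent_cone_Kset:
  fixes S :: "real^'p^'p"
  assumes S: "S \<in> psd_mats" and P: "polyhedron P" "v \<in> P"
  shows "tangent_cone (Kset P) (- S, v) =
    {h. transpose h = h \<and> - (ker_proj S ** h ** ker_proj S) \<in> psd_mats} \<times> radial_cone P v"
proof -
  have "- S \<in> nsd_mats" using S by (simp add: nsd_mats_iff)
  then have "tangent_cone (Kset P) (- S, v) = closure (radial_cone nsd_mats (- S) \<times> radial_cone P v)"
    using P(2) radial_cone_Times[OF convex_nsd_mats polyhedron_imp_convex[OF P(1)], of "- S" v]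
    by (simp only: tangent_cone_def Kset_def mem_Times_iff fst_conv snd_conv simp_thms if_True)
  then show ?thesis
    unfolding closure_Times tangent_cone_nsd[OF S] closure_closed[OF closed_radial_cone_polyhedron[OF P]] .
qed

text \<open>Separation inside the subspace \<open>Y\<close>.  Adding the orthogonal complement of \<open>Y\<close> to \<open>D\<close> keeps it away from
  a point of \<open>Y\<close> outside \<open>D\<close> and forces a separating functional to lie in \<open>Y\<close>.  A point outside a
  convex set, closed or not, is separated from it weakly, and on a cone the weak bound improves to \<open>0\<close>.\<close>

lemma separate_proper_cone:
  fixes D Y :: "'a::euclidean_space set"
  assumes Y: "subspace Y" and D: "convex D" "cone D" "D \<subseteq> Y" "D \<noteq> Y" "D \<noteq> {}"
  obtains a where "a \<in> Y" "a \<noteq> 0" "\<And>x. x \<in> D \<Longrightarrow> a \<bullet> x \<le> 0"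
proof -
  define C where "C = {x + k | x k. x \<in> D \<and> k \<in> Y\<^sup>\<bottom>}"
  have ortho: "k \<bullet> x = 0" if "k \<in> Y\<^sup>\<bottom>" "x \<in> Y" for k x
    using that by (auto simp: orthogonal_comp_def orthogonal_def inner_commute)
  obtain e where e: "e \<in> Y" "e \<notin> D" using D(3,4) by blast
  have "e \<notin> C"
  proof
    assume "e \<in> C"
    then obtain x k where xk: "e = x + k" "x \<in> D" "k \<in> Y\<^sup>\<bottom>" by (auto simp: C_def)
    then have "k \<in> Y" using e(1) D(3) subspace_diff[OF Y, of e x] by auto
    then have "k = 0" using ortho[OF xk(3)] by (metis inner_eq_zero_iff)
    then show False using xk e(2) by simp
  qed
  have "convex C"
  proof -
    have "C = (\<Union>x\<in>D. \<Union>k\<in>Y\<^sup>\<bottom>. {x + k})" by (auto simp: C_def)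
    then show ?thesis
      using convex_sums[OF D(1) subspace_imp_convex[OF subspace_orthogonal_comp[of Y]]] by metis
  qed
  moreover have "C \<noteq> {}"
    using D(5) subspace_0[OF subspace_orthogonal_comp[of Y]] unfolding C_def by blast
  ultimately obtain a b where a: "a \<noteq> 0" "\<And>x. x \<in> C \<Longrightarrow> a \<bullet> x \<le> b" "b \<le> a \<bullet> e"
    using separating_hyperplane_sets[of C "{e}"] \<open>e \<notin> C\<close> by auto
  have le: "a \<bullet> x \<le> 0" if x: "x \<in> C" for x
  proof (rule ccontr)
    assume "\<not> a \<bullet> x \<le> 0"
    then have pos: "a \<bullet> x > 0" by simp
    define r where "r = (\<bar>b\<bar> + 1) / (a \<bullet> x)"
    have r: "r \<ge> 0" using pos by (simp add: r_def)
    obtain d k where "x = d + k" "d \<in> D" "k \<in> Y\<^sup>\<bottom>" using x by (auto simp: C_def)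
    then have "r *\<^sub>R x = r *\<^sub>R d + r *\<^sub>R k" "r *\<^sub>R d \<in> D" "r *\<^sub>R k \<in> Y\<^sup>\<bottom>"
      using mem_cone[OF D(2) _ r] subspace_scale[OF subspace_orthogonal_comp[of Y]]
      by (auto simp: scaleR_add_right)
    then have "r *\<^sub>R x \<in> C" unfolding C_def by blast
    then have "r * (a \<bullet> x) \<le> b" using a(2) by fastforce
    then show False using pos by (simp add: r_def)
  qed
  have 0: "0 \<in> D" using cone_contains_0[OF D(2)] D(5) by simp
  have "a \<in> Y\<^sup>\<bottom>\<^sup>\<bottom>"
  proof -
    have "a \<bullet> k = 0" if "k \<in> Y\<^sup>\<bottom>" for k
    proof -
      have "0 + k \<in> C" "0 + - k \<in> C"
        using 0 that subspace_neg[OF subspace_orthogonal_comp that] unfolding C_def by blast+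
      then show ?thesis using le[of k] le[of "- k"] by simp
    qed
    then show ?thesis by (auto simp: orthogonal_comp_def[of "Y\<^sup>\<bottom>"] orthogonal_def inner_commute)
  qed
  then have "a \<in> Y" by (simp add: orthogonal_comp_self[OF Y])
  moreover have "a \<bullet> x \<le> 0" if "x \<in> D" for x
  proof -
    have "x + 0 \<in> C"
      using that subspace_0[OF subspace_orthogonal_comp[of Y]] unfolding C_def by blast
    then show ?thesis using le[of x] by simp
  qed
  ultimately show thesis using that a(1) by blast
qed

section \<open>Isolated calmness along directions\<close>

lemma has_derivative_along:
  fixes g :: "'a::real_normed_vector \<Rightarrow> 'b::real_normed_vector"
  assumes g: "(g has_derivative g') (at x)"
    and t: "\<forall>\<^sub>F n in F. t n > 0" "(t \<longlongrightarrow> 0) F" and d: "(d \<longlongrightarrow> D) F"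
  shows "((\<lambda>n. (1 / t n) *\<^sub>R (g (x + t n *\<^sub>R d n) - g x)) \<longlongrightarrow> g' D) F"
proof -
  interpret g': bounded_linear g' by (rule has_derivative_bounded_linear[OF g])
  define r where "r n = (1 / t n) *\<^sub>R (g (x + t n *\<^sub>R d n) - g x - g' (t n *\<^sub>R d n))" for n
  have "(r \<longlongrightarrow> 0) F"
  proof (rule tendstoI)
    fix e :: real assume "e > 0"
    define c where "c = e / (norm D + 2)"
    have D2: "norm D + 2 > 0" by (simp add: add_nonneg_pos)
    have "c > 0" using \<open>e > 0\<close> D2 by (simp add: c_def)
    then obtain \<delta> where \<delta>: "\<delta> > 0"
      "\<And>y. norm (y - x) < \<delta> \<Longrightarrow> norm (g y - g x - g' (y - x)) \<le> c * norm (y - x)"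
      using g unfolding has_derivative_at_alt by blast
    have td: "((\<lambda>n. t n *\<^sub>R d n) \<longlongrightarrow> 0 *\<^sub>R D) F" by (intro tendsto_intros t d)
    then have "\<forall>\<^sub>F n in F. norm (t n *\<^sub>R d n) < \<delta>"
      using \<delta>(1) by (auto simp: tendsto_iff dist_norm)
    moreover have "\<forall>\<^sub>F n in F. norm (d n) < norm D + 1"
      using tendsto_norm[OF d] by (rule order_tendstoD) simp
    ultimately show "\<forall>\<^sub>F n in F. dist (r n) 0 < e"
      using t(1)
    proof eventually_elim
      case (elim n)
      have "norm (g (x + t n *\<^sub>R d n) - g x - g' (t n *\<^sub>R d n)) \<le> c * norm (t n *\<^sub>R d n)"
        using \<delta>(2)[of "x + t n *\<^sub>R d n"] elim(1) by simp
      then have "t n * norm (r n) \<le> t n * (c * norm (d n))"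
        unfolding r_def norm_scaleR using elim(3) by (simp add: mult.left_commute)
      then have "norm (r n) \<le> c * norm (d n)"
        using elim(3) by simp
      also have "\<dots> \<le> c * (norm D + 1)" using elim(2) \<open>c > 0\<close> by simp
      also have "\<dots> < c * (norm D + 2)" using \<open>c > 0\<close> by simp
      also have "\<dots> = e" using D2 by (simp add: c_def)
      finally show ?case by simp
    qed
  qed
  then have "((\<lambda>n. r n + g' (d n)) \<longlongrightarrow> 0 + g' D) F"
    by (intro tendsto_intros g'.tendsto d)
  moreover have "\<forall>\<^sub>F n in F. r n + g' (d n) = (1 / t n) *\<^sub>R (g (x + t n *\<^sub>R d n) - g x)"
    using t(1) by (rule eventually_mono) (simp add: r_def g'.scaleR scaleR_diff_right)
  ultimately show ?thesis by (simp add: tendsto_cong)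
qed

text \<open>The way isolated calmness is used: a curve of solutions whose parameters move by \<open>o(t)\<close> cannot have
  nonzero velocity.\<close>

lemma isolated_calm_tangent:
  assumes calm: "isolated_calm F a b"
    and p: "\<forall>\<^sub>F t in at_right 0. b + t *\<^sub>R d t \<in> F (a + t *\<^sub>R \<alpha> t)"
    and d: "(d \<longlongrightarrow> D) (at_right 0)" and \<alpha>: "(\<alpha> \<longlongrightarrow> 0) (at_right 0)"
  shows "D = 0"
proof -
  obtain \<kappa> V W where V: "open V" "a \<in> V" and W: "open W" "b \<in> W"
    and *: "\<And>a' p. a' \<in> V \<Longrightarrow> p \<in> F a' \<Longrightarrow> p \<in> W \<Longrightarrow> norm (p - b) \<le> \<kappa> * norm (a' - a)"
    using calm unfolding isolated_calm_def by blast
  have id: "((\<lambda>t::real. t) \<longlongrightarrow> 0) (at_right 0)" by (rule tendsto_ident_at)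
  have "((\<lambda>t. a + t *\<^sub>R \<alpha> t) \<longlongrightarrow> a + 0 *\<^sub>R 0) (at_right 0)" by (intro tendsto_intros id \<alpha>)
  then have "\<forall>\<^sub>F t in at_right 0. a + t *\<^sub>R \<alpha> t \<in> V" using topological_tendstoD V by fastforce
  moreover have "((\<lambda>t. b + t *\<^sub>R d t) \<longlongrightarrow> b + 0 *\<^sub>R D) (at_right 0)" by (intro tendsto_intros id d)
  then have "\<forall>\<^sub>F t in at_right 0. b + t *\<^sub>R d t \<in> W" using topological_tendstoD W by fastforce
  moreover have "\<forall>\<^sub>F t :: real in at_right 0. t > 0" by (rule eventually_at_right_less)
  ultimately have "\<forall>\<^sub>F t in at_right 0. norm (d t) \<le> \<kappa> * norm (\<alpha> t)"
    using p
  proof eventually_elim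
    case (elim t)
    have "t * norm (d t) \<le> \<kappa> * (t * norm (\<alpha> t))"
      using *[OF elim(1) elim(4) elim(2)] elim(3) by simp
    then have "t * norm (d t) \<le> t * (\<kappa> * norm (\<alpha> t))" by (simp add: mult.left_commute)
    then show ?case using elim(3) by simp
  qed
  moreover have "((\<lambda>t. \<kappa> * norm (\<alpha> t)) \<longlongrightarrow> \<kappa> * norm (0 :: 'a)) (at_right 0)"
    by (intro tendsto_intros \<alpha>)
  ultimately have "norm D \<le> \<kappa> * norm (0 :: 'a)"
    by (intro tendsto_le[OF _ _ tendsto_norm[OF d]]) auto
  then show ?thesis by simp
qed

text \<open>The way isolated calmness is proved: a failure yields solutions whose distance from \<open>b\<close> exceeds
  every multiple of the parameter change.  Normalizing by the distance and using compactness of the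
  unit sphere gives a limit direction of norm one.\<close>

lemma isolated_calmI:
  fixes F :: "'a::real_normed_vector \<Rightarrow> 'b::euclidean_space set"
  assumes b: "b \<in> F a"
    and seq: "\<And>t \<alpha> d D. \<lbrakk>\<And>n. t n > 0; t \<longlonglongrightarrow> 0; \<And>n. b + t n *\<^sub>R d n \<in> F (a + t n *\<^sub>R \<alpha> n);
       \<alpha> \<longlonglongrightarrow> 0; d \<longlonglongrightarrow> D; norm D = 1\<rbrakk> \<Longrightarrow> False"
  shows "isolated_calm F a b"
proof (rule ccontr)
  assume not: "\<not> isolated_calm F a b"
  have "\<exists>a' p. p \<in> F a' \<and> p \<in> ball b (1 / Suc n) \<and> norm (p - b) > Suc n * norm (a' - a)" for n
  proof (rule ccontr)
    assume "\<not> ?thesis"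
    then have "\<forall>a'\<in>UNIV. F a' \<inter> ball b (1 / Suc n) \<subseteq> {p. norm (p - b) \<le> Suc n * norm (a' - a)}"
      by (force simp: not_less)
    moreover have "real (Suc n) > 0" "open (UNIV :: 'a set)" "a \<in> UNIV"
      "open (ball b (1 / Suc n))" "b \<in> ball b (1 / Suc n)" by auto
    ultimately show False using not b unfolding isolated_calm_def by blast
  qed
  then obtain a' p where p: "\<And>n. p n \<in> F (a' n)" "\<And>n. p n \<in> ball b (1 / Suc n)"
      "\<And>n. norm (p n - b) > Suc n * norm (a' n - a)"
    by metis
  define t where "t n = norm (p n - b)" for n
  have t: "t n > 0" for n
  proof -
    have "0 \<le> Suc n * norm (a' n - a)" by simp
    then show ?thesis using p(3)[of n] unfolding t_def by linarith
  qed
  have t1: "t n < 1 / Suc n" for n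
    using p(2)[of n] by (simp add: t_def dist_norm norm_minus_commute)
  have "t \<longlonglongrightarrow> 0"
    using t t1 by (intro real_tendsto_sandwich[OF _ _ tendsto_const LIMSEQ_Suc[OF lim_1_over_n]])
      (auto intro!: always_eventually less_imp_le simp del: of_nat_Suc)
  define \<alpha> where "\<alpha> n = (1 / t n) *\<^sub>R (a' n - a)" for n
  have \<alpha>1: "norm (\<alpha> n) \<le> 1 / Suc n" for n
  proof -
    have "norm (\<alpha> n) = norm (a' n - a) / t n" using t[of n] by (simp add: \<alpha>_def)
    then have "Suc n * norm (\<alpha> n) = (Suc n * norm (a' n - a)) / t n" by simp
    also have "\<dots> \<le> 1"
      using p(3)[of n] t[of n] by (simp only: t_def[symmetric] divide_le_eq_1_pos less_imp_le)
    finally show ?thesis by (simp add: pos_le_divide_eq mult.commute del: of_nat_Suc)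
  qed
  have "\<alpha> \<longlonglongrightarrow> 0"
    by (rule Lim_null_comparison[OF _ LIMSEQ_Suc[OF lim_1_over_n]]) (use \<alpha>1 in simp)
  define d where "d n = (1 / t n) *\<^sub>R (p n - b)" for n
  have d1: "d n \<in> sphere 0 1" for n using t[of n] by (simp add: d_def t_def)
  then obtain D r where r: "strict_mono (r :: nat \<Rightarrow> nat)" "D \<in> sphere 0 1" "(d \<circ> r) \<longlonglongrightarrow> D"
    using compact_sphere[of 0 1] unfolding compact_def by metis
  show False
  proof (rule seq)
    show "(t \<circ> r) n > 0" for n using t by simp
    show "(t \<circ> r) \<longlonglongrightarrow> 0" by (rule LIMSEQ_subseq_LIMSEQ[OF \<open>t \<longlonglongrightarrow> 0\<close> r(1)])
    show "(\<alpha> \<circ> r) \<longlonglongrightarrow> 0" by (rule LIMSEQ_subseq_LIMSEQ[OF \<open>\<alpha> \<longlonglongrightarrow> 0\<close> r(1)])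
    show "(d \<circ> r) \<longlonglongrightarrow> D" by (rule r(3))
    show "norm D = 1" using r(2) by simp
    have "b + t n *\<^sub>R d n = p n" "a + t n *\<^sub>R \<alpha> n = a' n" for n
      using t[of n] by (simp_all add: d_def \<alpha>_def)
    then show "b + (t \<circ> r) n *\<^sub>R (d \<circ> r) n \<in> F (a + (t \<circ> r) n *\<^sub>R (\<alpha> \<circ> r) n)" for n
      using p(1)[of "r n"] by simp
  qed
qed

section \<open>First-order limits of complementarity systems\<close>

text \<open>Expanding \<open>(y + t E\<^sub>n) ** (S - t H\<^sub>n) = 0\<close> and dividing by \<open>t\<close> gives equation \<open>1\<close> of the proof, whose
  limit is \<open>E ** S = y ** H\<close>.  Compressing equation \<open>1\<close> to the biactive block removes both first-order terms,
  so a second division by \<open>t\<close> is possible and gives the limit \<open>biactive ** E ** H ** biactive = 0\<close>.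
  Semidefiniteness of compressions and the sign of traces survive in the limit.\<close>

lemma (in complementary_psd) complementarity_limits:
  assumes t: "\<And>n. t n > 0" "t \<longlonglongrightarrow> 0" and H: "Hn \<longlonglongrightarrow> H" and E: "En \<longlonglongrightarrow> E"
    and c: "\<And>n. complementary_psd (S - t n *\<^sub>R Hn n) (y + t n *\<^sub>R En n)"
  shows "E ** S = y ** H" "biactive ** E ** H ** biactive = 0" "biactive ** E ** biactive \<in> psd_mats"
    "- (N ** H ** N) \<in> psd_mats" "y \<bullet> H = 0"
proof -
  note tendsto_mult_mat = bounded_bilinear.tendsto[OF bounded_bilinear_matrix_mult]
  have 1: "En n ** S - y ** Hn n - t n *\<^sub>R (En n ** Hn n) = 0" for n
  proof -
    interpret n: complementary_psd "S - t n *\<^sub>R Hn n" "y + t n *\<^sub>R En n" by (rule c)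
    have "t n *\<^sub>R (En n ** S - y ** Hn n - t n *\<^sub>R (En n ** Hn n)) = 0"
      using n.yS by (simp add: matrix_distribs yS algebra_simps)
    then show ?thesis using t(1)[of n] by simp
  qed
  have "(\<lambda>n. En n ** S - y ** Hn n - t n *\<^sub>R (En n ** Hn n)) \<longlonglongrightarrow> E ** S - y ** H - 0 *\<^sub>R (E ** H)"
    by (intro tendsto_intros tendsto_mult_mat t E H)
  then have "(\<lambda>n. 0) \<longlonglongrightarrow> E ** S - y ** H" unfolding 1 by simp
  then show ES: "E ** S = y ** H" by (simp add: LIMSEQ_const_iff)
  have 2: "biactive ** En n ** Hn n ** biactive = 0" for n
  proof -
    have "biactive ** (En n ** S - y ** Hn n - t n *\<^sub>R (En n ** Hn n)) ** biactive
      = biactive ** En n ** (S ** biactive) - (biactive ** y) ** Hn n ** biactive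
        - t n *\<^sub>R (biactive ** En n ** Hn n ** biactive)"
      by (simp add: matrix_distribs matrix_mul_assoc)
    then show ?thesis using t(1)[of n] by (simp add: 1 biactive_annihilates matrix_distribs)
  qed
  have "(\<lambda>n. biactive ** En n ** Hn n ** biactive) \<longlonglongrightarrow> biactive ** E ** H ** biactive"
    by (intro tendsto_intros tendsto_mult_mat E H)
  then show "biactive ** E ** H ** biactive = 0" unfolding 2 by (simp add: LIMSEQ_const_iff)
  have BEB: "biactive ** En n ** biactive \<in> psd_mats" for n
  proof -
    interpret n: complementary_psd "S - t n *\<^sub>R Hn n" "y + t n *\<^sub>R En n" by (rule c)
    have "transpose biactive ** (y + t n *\<^sub>R En n) ** biactive = t n *\<^sub>R (biactive ** En n ** biactive)"
      by (simp add: biactive_sym matrix_distribs biactive_annihilates)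
    then have "t n *\<^sub>R (biactive ** En n ** biactive) \<in> psd_mats"
      using psd_congruence[OF n.psd_y] by metis
    from psd_scaleR[OF _ this, of "1 / t n"] show ?thesis using t(1)[of n] by simp
  qed
  have "(\<lambda>n. biactive ** En n ** biactive) \<longlonglongrightarrow> biactive ** E ** biactive"
    by (intro tendsto_intros tendsto_mult_mat E)
  then show "biactive ** E ** biactive \<in> psd_mats"
    by (rule closed_sequentially[OF closed_psd_mats, rotated]) (rule BEB)
  have NHN: "- (N ** Hn n ** N) \<in> psd_mats" for n
  proof -
    interpret n: complementary_psd "S - t n *\<^sub>R Hn n" "y + t n *\<^sub>R En n" by (rule c)
    have "transpose N ** (S - t n *\<^sub>R Hn n) ** N = t n *\<^sub>R (- (N ** Hn n ** N))"
      by (simp add: pinv_S matrix_distribs)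
    then have "t n *\<^sub>R (- (N ** Hn n ** N)) \<in> psd_mats"
      using psd_congruence[OF n.psd_S] by metis
    from psd_scaleR[OF _ this, of "1 / t n"] show ?thesis using t(1)[of n] by simp
  qed
  have "(\<lambda>n. - (N ** Hn n ** N)) \<longlonglongrightarrow> - (N ** H ** N)"
    by (intro tendsto_intros tendsto_mult_mat H)
  then show "- (N ** H ** N) \<in> psd_mats"
    by (rule closed_sequentially[OF closed_psd_mats, rotated]) (rule NHN)
  have yH: "y \<bullet> Hn n \<le> 0" "0 \<le> En n \<bullet> S" for n
  proof -
    interpret n: complementary_psd "S - t n *\<^sub>R Hn n" "y + t n *\<^sub>R En n" by (rule c)
    show "y \<bullet> Hn n \<le> 0"
      using psd_inner_nonneg[OF psd_y n.psd_S] t(1)[of n]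
      by (simp add: inner_diff_right inner_zero mult_le_0_iff)
    show "0 \<le> En n \<bullet> S"
      using psd_inner_nonneg[OF n.psd_y psd_S] t(1)[of n]
      by (simp add: inner_add_left inner_zero zero_le_mult_iff)
  qed
  have "y \<bullet> H \<le> 0"
    by (rule LIMSEQ_le_const2[OF tendsto_inner[OF tendsto_const H]]) (use yH(1) in blast)
  moreover have "0 \<le> E \<bullet> S"
    by (rule LIMSEQ_le_const[OF tendsto_inner[OF E tendsto_const]]) (use yH(2) in blast)
  moreover have "E \<bullet> S = y \<bullet> H"
  proof -
    have "E \<bullet> S = (E ** S) \<bullet> mat 1"
      by (simp add: inner_matrix_mult_right sym_S)
    also have "\<dots> = y \<bullet> H"
      unfolding ES by (simp add: inner_matrix_mult_left sym_y) (rule inner_commute)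
    finally show ?thesis .
  qed
  ultimately show "y \<bullet> H = 0" by simp
qed

text \<open>The sign facts come from testing normality of \<open>z + t e\<^sub>n\<close> and of \<open>z\<close> against each other's base
  points.  For the last claim a direction \<open>l\<close> of the closed radial cone is feasible for a positive step
  \<open>s\<close>, so normality of \<open>z + t e\<^sub>n\<close> can be tested at \<open>v + s l\<close>.\<close>

lemma polyhedral_complementarity_limits:
  fixes P :: "'a::euclidean_space set"
  assumes P: "polyhedron P" "v \<in> P" and z: "\<And>p. p \<in> P \<Longrightarrow> z \<bullet> (p - v) \<le> 0"
    and t: "\<And>n. t n > 0" "t \<longlonglongrightarrow> 0" and k: "kn \<longlonglongrightarrow> k" and e: "en \<longlonglongrightarrow> e"
    and vn: "\<And>n. v + t n *\<^sub>R kn n \<in> P"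
    and zn: "\<And>n p. p \<in> P \<Longrightarrow> (z + t n *\<^sub>R en n) \<bullet> (p - (v + t n *\<^sub>R kn n)) \<le> 0"
  shows "k \<in> radial_cone P v" "z \<bullet> k = 0" "0 \<le> e \<bullet> k"
    "\<And>l. k = 0 \<Longrightarrow> l \<in> radial_cone P v \<Longrightarrow> z \<bullet> l = 0 \<Longrightarrow> e \<bullet> l \<le> 0"
proof -
  have "kn n \<in> radial_cone P v" for n
    unfolding radial_cone_iff[OF P(2)] using t(1) vn by blast
  then show "k \<in> radial_cone P v"
    using closed_sequentially[OF closed_radial_cone_polyhedron[OF P] _ k] by blast
  have zk: "z \<bullet> kn n \<le> 0" for n
    using z[OF vn, of n] t(1)[of n] by (simp add: mult_le_0_iff)
  have zek: "0 \<le> (z + t n *\<^sub>R en n) \<bullet> kn n" for n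
  proof -
    have "t n * ((z + t n *\<^sub>R en n) \<bullet> kn n) = - ((z + t n *\<^sub>R en n) \<bullet> (v - (v + t n *\<^sub>R kn n)))"
      by (simp add: inner_diff_right inner_add_right)
    also have "\<dots> \<ge> 0" using zn[OF P(2), of n] by simp
    finally show ?thesis using t(1)[of n] by (simp add: zero_le_mult_iff)
  qed
  have "z \<bullet> k \<le> 0"
    by (rule LIMSEQ_le_const2[OF tendsto_inner[OF tendsto_const k]]) (use zk in blast)
  moreover have "(\<lambda>n. (z + t n *\<^sub>R en n) \<bullet> kn n) \<longlonglongrightarrow> (z + 0 *\<^sub>R e) \<bullet> k"
    by (intro tendsto_intros t k e)
  then have "0 \<le> (z + 0 *\<^sub>R e) \<bullet> k"
    by (rule LIMSEQ_le_const) (use zek in blast)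
  ultimately show "z \<bullet> k = 0" by simp
  have ek: "0 \<le> en n \<bullet> kn n" for n
  proof -
    have "0 \<le> t n * (en n \<bullet> kn n)" using zek[of n] zk[of n] by (simp add: inner_add_left)
    then show ?thesis using t(1)[of n] by (simp add: zero_le_mult_iff)
  qed
  show "0 \<le> e \<bullet> k"
    by (rule LIMSEQ_le_const[OF tendsto_inner[OF e k]]) (use ek in blast)
  show "e \<bullet> l \<le> 0" if k0: "k = 0" and l: "l \<in> radial_cone P v" "z \<bullet> l = 0" for l
  proof -
    obtain s where s: "s > 0" "v + s *\<^sub>R l \<in> P" using l(1) radial_cone_iff[OF P(2)] by blast
    have "s * (en n \<bullet> l) \<le> (z + t n *\<^sub>R en n) \<bullet> kn n" for n
    proof -
      have "(z + t n *\<^sub>R en n) \<bullet> (s *\<^sub>R l - t n *\<^sub>R kn n) \<le> 0"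
        using zn[OF s(2), of n] by (simp add: algebra_simps)
      then have "t n * (s * (en n \<bullet> l)) \<le> t n * ((z + t n *\<^sub>R en n) \<bullet> kn n)"
        using l(2) by (simp add: inner_diff_right inner_add_left algebra_simps)
      then show ?thesis using t(1)[of n] by simp
    qed
    moreover have "(\<lambda>n. s * (en n \<bullet> l)) \<longlonglongrightarrow> s * (e \<bullet> l)" by (intro tendsto_intros e)
    ultimately have "s * (e \<bullet> l) \<le> (z + 0 *\<^sub>R e) \<bullet> k"
      using \<open>_ \<longlonglongrightarrow> (z + 0 *\<^sub>R e) \<bullet> k\<close> LIMSEQ_le by blast
    then show ?thesis using k0 s(1) by (simp add: mult_le_0_iff)
  qed
qed

section \<open>Derivatives of the Lagrangian\<close>

locale smooth_program =
  fixes f :: "'x::euclidean_space \<Rightarrow> real"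
    and \<phi> :: "'x \<Rightarrow> real^'p^'p"
    and \<psi> :: "'x \<Rightarrow> 'z::euclidean_space"
    and f' :: "'x \<Rightarrow> 'x \<Rightarrow>\<^sub>L real" and f'' :: "'x \<Rightarrow> 'x \<Rightarrow>\<^sub>L ('x \<Rightarrow>\<^sub>L real)"
    and \<phi>' :: "'x \<Rightarrow> 'x \<Rightarrow>\<^sub>L (real^'p^'p)" and \<phi>'' :: "'x \<Rightarrow> 'x \<Rightarrow>\<^sub>L ('x \<Rightarrow>\<^sub>L (real^'p^'p))"
    and \<psi>' :: "'x \<Rightarrow> 'x \<Rightarrow>\<^sub>L 'z" and \<psi>'' :: "'x \<Rightarrow> 'x \<Rightarrow>\<^sub>L ('x \<Rightarrow>\<^sub>L 'z)"
  assumes f': "\<And>x. (f has_derivative f' x) (at x)" and f'': "\<And>x. (f' has_derivative f'' x) (at x)"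
    and \<phi>': "\<And>x. (\<phi> has_derivative \<phi>' x) (at x)" and \<phi>'': "\<And>x. (\<phi>' has_derivative \<phi>'' x) (at x)"
    and \<psi>': "\<And>x. (\<psi> has_derivative \<psi>' x) (at x)" and \<psi>'': "\<And>x. (\<psi>' has_derivative \<psi>'' x) (at x)"
    and sym_values: "\<And>x. transpose (\<phi> x) = \<phi> x"
begin

lemma Der_simps: "Der f x = f' x" "Der \<phi> x = \<phi>' x" "Der (Gmap \<phi> \<psi>) x = (\<lambda>d. (\<phi>' x d, \<psi>' x d))"
proof -
  have "(Gmap \<phi> \<psi> has_derivative (\<lambda>d. (\<phi>' x d, \<psi>' x d))) (at x)"
    unfolding Gmap_def[abs_def] by (intro has_derivative_Pair \<phi>' \<psi>')
  then show "Der f x = f' x" "Der \<phi> x = \<phi>' x" "Der (Gmap \<phi> \<psi>) x = (\<lambda>d. (\<phi>' x d, \<psi>' x d))"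
    using frechet_derivative_at f' \<phi>' by metis+
qed

lemma sym_derivative: "transpose (\<phi>' x d) = \<phi>' x d"
proof -
  have "((\<lambda>x. transpose (\<phi> x)) has_derivative (\<lambda>d. transpose (\<phi>' x d))) (at x)"
    by (rule bounded_linear.has_derivative[OF bounded_linear_transpose \<phi>'])
  then have "(\<phi> has_derivative (\<lambda>d. transpose (\<phi>' x d))) (at x)"
    by (simp add: sym_values)
  from has_derivative_unique[OF this \<phi>'] show ?thesis by metis
qed

text \<open>The gradient of the Lagrangian in coordinates; in this form it is visibly differentiable in \<open>x\<close>.\<close>

definition Lgrad :: "real^'p^'p \<Rightarrow> 'z \<Rightarrow> 'x \<Rightarrow> 'x" where
  "Lgrad y z x = (\<Sum>b\<in>Basis. (f' x b + y \<bullet> \<phi>' x b + z \<bullet> \<psi>' x b) *\<^sub>R b)"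

lemma Lgrad_inner: "d \<bullet> Lgrad y z x = f' x d + y \<bullet> \<phi>' x d + z \<bullet> \<psi>' x d"
proof -
  define l where "l d = f' x d + y \<bullet> \<phi>' x d + z \<bullet> \<psi>' x d" for d
  have lin: "linear l"
    unfolding l_def by (intro linearI) (simp_all add: blinfun.add_right blinfun.scaleR_right
      inner_add_right algebra_simps)
  have "l d = l (\<Sum>b\<in>Basis. (d \<bullet> b) *\<^sub>R b)" by (simp add: euclidean_representation)
  also have "\<dots> = (\<Sum>b\<in>Basis. (d \<bullet> b) * l b)"
    by (simp add: linear_sum[OF lin] linear_scale[OF lin])
  also have "\<dots> = d \<bullet> Lgrad y z x"
    by (simp add: inner_sum_right Lgrad_def l_def mult.commute)
  finally show ?thesis by (simp only: l_def)
qed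

lemma gradL_eq: "gradL f \<phi> \<psi> y z x = Lgrad y z x"
proof -
  have "(lagrangian f \<phi> \<psi> y z has_derivative (\<lambda>d. d \<bullet> Lgrad y z x)) (at x)"
    unfolding Lgrad_inner lagrangian_def[abs_def]
    by (intro has_derivative_add f' has_derivative_inner_right \<phi>' \<psi>')
  then have G: "GDERIV (lagrangian f \<phi> \<psi> y z) x :> Lgrad y z x"
    unfolding gderiv_def .
  have "D = Lgrad y z x" if "GDERIV (lagrangian f \<phi> \<psi> y z) x :> D" for D
  proof -
    have "(\<lambda>h. h \<bullet> D) = (\<lambda>h. h \<bullet> Lgrad y z x)"
      by (rule has_derivative_unique[OF that[unfolded gderiv_def] G[unfolded gderiv_def]])
    then have "h \<bullet> D = h \<bullet> Lgrad y z x" for h by (rule fun_cong)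
    then show ?thesis using vector_eq_ldot[of D "Lgrad y z x"] by blast
  qed
  with G show ?thesis
    unfolding gradL_def grad_def by (rule the_equality)
qed

lemma gradL_inner: "gradL f \<phi> \<psi> y z x \<bullet> d = f' x d + y \<bullet> \<phi>' x d + z \<bullet> \<psi>' x d"
  unfolding gradL_eq by (subst inner_commute) (rule Lgrad_inner)

lemma gradL_shift:
  "gradL f \<phi> \<psi> (y + y') (z + z') x \<bullet> d = gradL f \<phi> \<psi> y z x \<bullet> d + y' \<bullet> \<phi>' x d + z' \<bullet> \<psi>' x d"
  by (simp add: gradL_inner inner_add_left)

lemma hessL: "(gradL f \<phi> \<psi> y z has_derivative hessL f \<phi> \<psi> y z x) (at x)"
proof -
  note app = bounded_linear.has_derivative[OF blinfun.bounded_linear_left]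
  have "((\<lambda>x. \<Sum>b\<in>Basis. (f' x b + y \<bullet> \<phi>' x b + z \<bullet> \<psi>' x b) *\<^sub>R b) has_derivative
      (\<lambda>d. \<Sum>b\<in>Basis. (f'' x d b + y \<bullet> \<phi>'' x d b + z \<bullet> \<psi>'' x d b) *\<^sub>R b)) (at x)"
    by (intro has_derivative_sum has_derivative_scaleR_left has_derivative_add
        has_derivative_inner_right app[OF f''] app[OF \<phi>''] app[OF \<psi>''])
  then have "gradL f \<phi> \<psi> y z differentiable (at x)"
    unfolding gradL_eq[abs_def] Lgrad_def differentiable_def by blast
  then show ?thesis
    unfolding hessL_def by (simp add: frechet_derivative_works)
qed

end

lemma twice_cont_diffE:
  assumes "twice_cont_diff g"
  obtains g' g'' where "\<And>x. (g has_derivative blinfun_apply (g' x)) (at x)"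
    "\<And>x. (g' has_derivative blinfun_apply (g'' x)) (at x)"
proof -
  from assms[unfolded twice_cont_diff_def] show thesis
  proof (elim exE conjE)
    fix g' g''
    assume "\<forall>x. (g has_derivative blinfun_apply (g' x)) (at x)"
      and "\<forall>x. (g' has_derivative blinfun_apply (g'' x)) (at x)"
    then show thesis by (intro that[of g' g'']) (simp_all only:)
  qed
qed

section \<open>KKT points and perturbed KKT systems\<close>

locale kkt_point = smooth_program f \<phi> \<psi> f' f'' \<phi>' \<phi>'' \<psi>' \<psi>''
  for f :: "'x::euclidean_space \<Rightarrow> real"
    and \<phi> :: "'x \<Rightarrow> real^'p^'p"
    and \<psi> :: "'x \<Rightarrow> 'z::euclidean_space"
    and f' f'' \<phi>' \<phi>'' \<psi>' \<psi>'' +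
  fixes P :: "'z set" and xb :: 'x and yb :: "real^'p^'p" and zb :: 'z
  assumes polyP: "polyhedron P" and multiplier: "(yb, zb) \<in> multipliers f \<phi> \<psi> P xb"

begin

lemma multiplierD: "gradL f \<phi> \<psi> yb zb xb = 0" "complementary_psd (- \<phi> xb) yb" "\<psi> xb \<in> P"
  "\<And>p. p \<in> P \<Longrightarrow> zb \<bullet> (p - \<psi> xb) \<le> 0"
proof -
  have *: "gradL f \<phi> \<psi> yb zb xb = 0 \<and> (yb, zb) \<in> normal_cone Yspace (Kset P) (\<phi> xb, \<psi> xb)"
    using multiplier unfolding multipliers_def Gmap_def by (simp only: mem_Collect_eq prod.case)
  then show "gradL f \<phi> \<psi> yb zb xb = 0" by (rule conjunct1)
  have "complementary_psd (- \<phi> xb) yb \<and> \<psi> xb \<in> P \<and> (\<forall>p\<in>P. zb \<bullet> (p - \<psi> xb) \<le> 0)"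
    using * normal_cone_Kset_iff[of yb zb P "- \<phi> xb" "\<psi> xb", unfolded minus_minus] by blast
  then show "complementary_psd (- \<phi> xb) yb" "\<psi> xb \<in> P"
    "\<And>p. p \<in> P \<Longrightarrow> zb \<bullet> (p - \<psi> xb) \<le> 0" by blast+
qed

end

sublocale kkt_point \<subseteq> complementary_psd "- \<phi> xb" yb
  by (rule multiplierD(2))

context kkt_point
begin

lemma convex_K: "convex (Kset P)"
  unfolding Kset_def by (rule convex_Times[OF convex_nsd_mats polyhedron_imp_convex[OF polyP]])

lemma closed_K: "closed (Kset P)"
  unfolding Kset_def by (rule closed_Times[OF closed_nsd_mats polyhedron_imp_closed[OF polyP]])

lemma K_nonempty: "Kset P \<noteq> {}"
proof -
  have "(0, \<psi> xb) \<in> Kset P"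
    using multiplierD(3) psd_zero by (simp add: Kset_def nsd_mats_iff)
  then show ?thesis by blast
qed

lemma tangent_K: "tangent_cone (Kset P) (Gmap \<phi> \<psi> xb) =
    {h. transpose h = h \<and> - (N ** h ** N) \<in> psd_mats} \<times> radial_cone P (\<psi> xb)"
  using tangent_cone_Kset[OF psd_S polyP multiplierD(3)] by (simp add: Gmap_def)

text \<open>A residual \<open>(b, c)\<close> in the projection equation says that \<open>(\<phi> x + b, \<psi> x + c)\<close> is the projection of itself
  plus \<open>(y - b, z - c)\<close>, that is, that \<open>(y - b, z - c)\<close> is normal there.\<close>

lemma KKT_inv_iff:
  "(x, y, z) \<in> KKT_inv f \<phi> \<psi> P (a, b, c) \<longleftrightarrow> transpose y = y \<and> gradL f \<phi> \<psi> y z x = a \<and>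
     complementary_psd (- (\<phi> x + b)) (y - b) \<and> \<psi> x + c \<in> P \<and>
     (\<forall>p\<in>P. (z - c) \<bullet> (p - (\<psi> x + c)) \<le> 0)"
proof -
  have "KKT f \<phi> \<psi> P (x, y, z) = (a, b, c) \<longleftrightarrow> gradL f \<phi> \<psi> y z x = a \<and>
      closest_point (Kset P) ((\<phi> x + b, \<psi> x + c) + (y - b, z - c)) = (\<phi> x + b, \<psi> x + c)"
    unfolding KKT_def Gmap_def by (auto simp: algebra_simps add_eq_0_iff prod_eq_iff)
  also have "\<dots> \<longleftrightarrow> gradL f \<phi> \<psi> y z x = a \<and> (\<phi> x + b, \<psi> x + c) \<in> Kset P \<and>
      (\<forall>k\<in>Kset P. (y - b, z - c) \<bullet> (k - (\<phi> x + b, \<psi> x + c)) \<le> 0)"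
    by (simp only: closest_point_add_eq_iff[OF convex_K closed_K K_nonempty])
  finally have 1: "(x, y, z) \<in> KKT_inv f \<phi> \<psi> P (a, b, c) \<longleftrightarrow>
     transpose y = y \<and> gradL f \<phi> \<psi> y z x = a \<and> (\<phi> x + b, \<psi> x + c) \<in> Kset P \<and>
      (\<forall>k\<in>Kset P. (y - b, z - c) \<bullet> (k - (\<phi> x + b, \<psi> x + c)) \<le> 0)"
    by (auto simp: KKT_inv_def Yspace_def sym_mats_def)
  have "transpose b = b" if "(\<phi> x + b, \<psi> x + c) \<in> Kset P"
  proof -
    have "transpose (- (\<phi> x + b)) = - (\<phi> x + b)"
      using that by (intro psd_symD) (auto simp: Kset_def nsd_mats_iff)
    then show ?thesis by (simp add: transpose_distribs sym_values)
  qed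
  then have 2: "transpose y = y \<and> (\<phi> x + b, \<psi> x + c) \<in> Kset P \<and>
      (\<forall>k\<in>Kset P. (y - b, z - c) \<bullet> (k - (\<phi> x + b, \<psi> x + c)) \<le> 0) \<longleftrightarrow>
    transpose y = y \<and> (y - b, z - c) \<in> normal_cone Yspace (Kset P) (\<phi> x + b, \<psi> x + c)"
    by (auto simp: normal_cone_def Yspace_def sym_mats_def transpose_distribs)
  have "(x, y, z) \<in> KKT_inv f \<phi> \<psi> P (a, b, c) \<longleftrightarrow> gradL f \<phi> \<psi> y z x = a \<and>
      (transpose y = y \<and> (y - b, z - c) \<in> normal_cone Yspace (Kset P) (\<phi> x + b, \<psi> x + c))"
    unfolding 1 2[symmetric] by (rule iffI; elim conjE; intro conjI; assumption)
  then show ?thesis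
    unfolding normal_cone_Kset_iff[of "y - b" "z - c" P "- (\<phi> x + b)" "\<psi> x + c", unfolded minus_minus]
    by blast
qed

section \<open>The strict Robinson condition in dual form\<close>

text \<open>The set \<open>T\<^sub>K(G(xb)) \<inter> (yb, zb)\<^sup>\<bottom>\<close> of the strict Robinson condition, split into its two components.  The
  splitting is possible because \<open>yb\<close> and \<open>zb\<close> are separately nonpositive on the tangent cone
  (\<open>multiplier_polar\<close>); \<open>critical_pair_iff\<close> identifies the two sets.\<close>

definition critical_pair :: "real^'p^'p \<Rightarrow> 'z \<Rightarrow> bool" where
  "critical_pair h k \<longleftrightarrow> transpose h = h \<and> - (N ** h ** N) \<in> psd_mats \<and> yb \<bullet> h = 0 \<and>
     k \<in> radial_cone P (\<psi> xb) \<and> zb \<bullet> k = 0"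

lemma multiplier_polar:
  assumes "(h, k) \<in> tangent_cone (Kset P) (Gmap \<phi> \<psi> xb)"
  shows "yb \<bullet> h \<le> 0" "zb \<bullet> k \<le> 0"
proof -
  have h: "- (N ** h ** N) \<in> psd_mats" and k: "k \<in> radial_cone P (\<psi> xb)"
    using assms by (auto simp: tangent_K)
  have "0 \<le> yb \<bullet> (- (N ** h ** N))" by (rule psd_inner_nonneg[OF psd_y h])
  also have "\<dots> = - ((N ** yb ** N) \<bullet> h)" by (simp add: inner_congruence pinv_S)
  also have "\<dots> = - (yb \<bullet> h)" by (simp add: Ny yN)
  finally show "yb \<bullet> h \<le> 0" by simp
  obtain s where "s > 0" "\<psi> xb + s *\<^sub>R k \<in> P"
    using k radial_cone_iff[OF multiplierD(3)] by blast
  then show "zb \<bullet> k \<le> 0"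
    using multiplierD(4)[of "\<psi> xb + s *\<^sub>R k"] by (simp add: mult_le_0_iff)
qed

lemma critical_pair_iff:
  "critical_pair h k \<longleftrightarrow>
     (h, k) \<in> tangent_cone (Kset P) (Gmap \<phi> \<psi> xb) \<and> 0 \<le> yb \<bullet> h + zb \<bullet> k"
  using multiplier_polar[of h k] unfolding critical_pair_def tangent_K by auto

text \<open>Stationarity turns \<open>Df(xb) d \<le> 0\<close> into \<open>0 \<le> yb \<bullet> \<phi>' d + zb \<bullet> \<psi>' d\<close>.\<close>

lemma critical_cone_iff:
  "d \<in> critical_cone f \<phi> \<psi> P xb \<longleftrightarrow> critical_pair (\<phi>' xb d) (\<psi>' xb d)"
proof -
  have "f' xb d + yb \<bullet> \<phi>' xb d + zb \<bullet> \<psi>' xb d = 0"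
    using gradL_inner[of yb zb xb d] multiplierD(1) by simp
  then have "f' xb d \<le> 0 \<longleftrightarrow> 0 \<le> yb \<bullet> \<phi>' xb d + zb \<bullet> \<psi>' xb d" by linarith
  then show ?thesis
    unfolding critical_pair_iff critical_cone_def Der_simps by simp
qed

lemma zero_in_radial: "0 \<in> radial_cone P (\<psi> xb)"
  using multiplierD(3) by (auto simp: radial_cone_iff intro: exI[of _ 1])

lemma critical_pair_left: "critical_pair h 0 \<longleftrightarrow> transpose h = h \<and> - (N ** h ** N) \<in> psd_mats \<and> yb \<bullet> h = 0"
  using zero_in_radial by (auto simp: critical_pair_def)

lemma critical_pair_right: "critical_pair 0 k \<longleftrightarrow> k \<in> radial_cone P (\<psi> xb) \<and> zb \<bullet> k = 0"
  by (auto simp: critical_pair_def transpose_distribs matrix_distribs psd_zero)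

text \<open>The polar of the cone in the strict Robinson condition: directions in which the multiplier can
  move to first order without violating the KKT conditions.\<close>

definition dual_direction :: "real^'p^'p \<Rightarrow> 'z \<Rightarrow> bool" where
  "dual_direction y z \<longleftrightarrow> transpose y = y \<and> (\<forall>d. y \<bullet> \<phi>' xb d + z \<bullet> \<psi>' xb d = 0) \<and>
     (\<forall>h k. critical_pair h k \<longrightarrow> y \<bullet> h + z \<bullet> k \<le> 0)"

text \<open>If the sum of the range and the cone is everything, a dual direction is nonpositive on itself, hence
  zero.  Otherwise the sum is a proper convex cone and a separating functional is a dual
  direction.\<close>

lemma SRCQ_iff: "SRCQ \<phi> \<psi> P xb yb zb \<longleftrightarrow> (\<forall>y z. dual_direction y z \<longrightarrow> y = 0 \<and> z = 0)"
proof -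
  define T where "T = {(h, k). critical_pair h k}"
  define R where "R = range (\<lambda>d. (\<phi>' xb d, \<psi>' xb d))"
  define D where "D = (\<Union>u\<in>R. \<Union>v\<in>T. {u + v})"
  have T: "tangent_cone (Kset P) (Gmap \<phi> \<psi> xb) \<inter> {w. w \<bullet> (yb, zb) = 0} = T"
  proof (rule set_eqI)
    fix w :: "(real^'p^'p) \<times> 'z"
    obtain h k where w: "w = (h, k)" by (cases w)
    have "w \<bullet> (yb, zb) = yb \<bullet> h + zb \<bullet> k" by (simp add: w inner_commute)
    then show "w \<in> tangent_cone (Kset P) (Gmap \<phi> \<psi> xb) \<inter> {w. w \<bullet> (yb, zb) = 0} \<longleftrightarrow> w \<in> T"
      using multiplier_polar[of h k] critical_pair_iff[of h k] by (auto simp: w T_def)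
  qed
  have D_eq: "D = {u + v | u v. u \<in> R \<and> v \<in> T}" unfolding D_def by blast
  have SRCQ: "SRCQ \<phi> \<psi> P xb yb zb \<longleftrightarrow> D = Yspace"
    unfolding SRCQ_def T Der_simps R_def[symmetric] D_eq by (rule refl)
  have subY: "subspace (Yspace :: ((real^'p^'p) \<times> 'z) set)"
    by (rule subspaceI) (auto simp: Yspace_def sym_mats_def transpose_distribs zero_prod_def)
  have linR: "linear (\<lambda>d. (\<phi>' xb d, \<psi>' xb d))"
    by (intro linearI) (simp_all add: blinfun.add_right blinfun.scaleR_right)
  have subR: "subspace R" unfolding R_def by (rule linear_subspace_image[OF linR subspace_UNIV])
  have convT: "convex T"
  proof -
    have "convex (radial_cone P (\<psi> xb))"
    proof -
      have "(\<lambda>k. k - \<psi> xb) ` P = (\<lambda>k. - \<psi> xb + k) ` P" by simp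
      then show ?thesis
        using convex_cone_hull[OF convex_translation[OF polyhedron_imp_convex[OF polyP], of "- \<psi> xb"]] by metis
    qed
    moreover have "convex {h. critical_pair h 0}"
      unfolding critical_pair_left
    proof (rule convexI, clarsimp)
      fix g h :: "real^'p^'p" and u v :: real
      assume A: "0 \<le> u" "0 \<le> v" "u + v = 1" "transpose g = g" "- (N ** g ** N) \<in> psd_mats" "yb \<bullet> g = 0"
        "transpose h = h" "- (N ** h ** N) \<in> psd_mats" "yb \<bullet> h = 0"
      have "- (N ** (u *\<^sub>R g + v *\<^sub>R h) ** N) = u *\<^sub>R (- (N ** g ** N)) + v *\<^sub>R (- (N ** h ** N))"
        by (simp add: matrix_distribs)
      also have "\<dots> \<in> psd_mats" using A by (intro psd_add psd_scaleR) auto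
      finally show "transpose (u *\<^sub>R g + v *\<^sub>R h) = u *\<^sub>R g + v *\<^sub>R h \<and>
          - (N ** (u *\<^sub>R g + v *\<^sub>R h) ** N) \<in> psd_mats \<and> yb \<bullet> (u *\<^sub>R g + v *\<^sub>R h) = 0"
        using A by (simp add: transpose_distribs inner_add_right)
    qed
    moreover have "convex {k. zb \<bullet> k = 0}" by (rule convex_hyperplane)
    moreover have "T = {h. critical_pair h 0} \<times> (radial_cone P (\<psi> xb) \<inter> {k. zb \<bullet> k = 0})"
      unfolding T_def critical_pair_left by (auto simp: critical_pair_def)
    ultimately show ?thesis by (simp add: convex_Times convex_Int)
  qed
  have coneT: "cone T"
    unfolding cone_def
  proof (intro ballI allI impI)
    fix w and c :: real assume "w \<in> T" and c: "0 \<le> c"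
    then obtain h k where w: "w = (h, k)" "critical_pair h k" by (auto simp: T_def)
    have eq: "- (N ** (c *\<^sub>R h) ** N) = c *\<^sub>R (- (N ** h ** N))" by (simp add: matrix_distribs)
    have "- (N ** (c *\<^sub>R h) ** N) \<in> psd_mats"
      unfolding eq using w(2) c by (intro psd_scaleR) (simp_all add: critical_pair_def)
    moreover have "c *\<^sub>R k \<in> radial_cone P (\<psi> xb)"
      using w(2) by (intro mem_cone[OF cone_cone_hull _ c]) (simp add: critical_pair_def)
    ultimately have "critical_pair (c *\<^sub>R h) (c *\<^sub>R k)"
      using w(2) by (simp add: critical_pair_def transpose_distribs)
    then show "c *\<^sub>R w \<in> T" by (simp add: T_def w)
  qed
  have T0: "0 \<in> T" using zero_in_radial
    by (auto simp: T_def zero_prod_def critical_pair_right)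
  have R0: "0 \<in> R" by (rule subspace_0[OF subR])
  have "convex D" unfolding D_def by (rule convex_sums[OF subspace_imp_convex[OF subR] convT])
  have "cone D"
    unfolding cone_def
  proof (intro ballI allI impI)
    fix w and c :: real assume "w \<in> D" and c: "0 \<le> c"
    then obtain u v where "w = u + v" "u \<in> R" "v \<in> T" by (auto simp: D_def)
    then have "c *\<^sub>R w = c *\<^sub>R u + c *\<^sub>R v" "c *\<^sub>R u \<in> R" "c *\<^sub>R v \<in> T"
      using subspace_scale[OF subR] mem_cone[OF coneT _ c] by (auto simp: scaleR_add_right)
    then show "c *\<^sub>R w \<in> D" unfolding D_def by blast
  qed
  have "R \<subseteq> Yspace" "T \<subseteq> Yspace"
    by (auto simp: R_def T_def Yspace_def sym_mats_def sym_derivative critical_pair_def)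
  then have "D \<subseteq> Yspace" using subspace_add[OF subY] unfolding D_def by blast
  have RD: "R \<subseteq> D"
  proof
    fix r assume "r \<in> R"
    then have "r + 0 \<in> D" using T0 unfolding D_def by blast
    then show "r \<in> D" by simp
  qed
  have TD: "T \<subseteq> D"
  proof
    fix r assume "r \<in> T"
    then have "0 + r \<in> D" using R0 unfolding D_def by blast
    then show "r \<in> D" by simp
  qed
  show ?thesis
  proof
    assume "SRCQ \<phi> \<psi> P xb yb zb"
    then have D: "D = Yspace" by (simp add: SRCQ)
    show "\<forall>y z. dual_direction y z \<longrightarrow> y = 0 \<and> z = 0"
    proof (intro allI impI)
      fix y z assume dd: "dual_direction y z"
      then have "(y, z) \<in> D" unfolding D by (simp add: dual_direction_def Yspace_def sym_mats_def)
      then obtain d h k where yz: "y = \<phi>' xb d + h" "z = \<psi>' xb d + k" and hk: "critical_pair h k"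
        unfolding D_def R_def T_def by auto
      have "y \<bullet> \<phi>' xb d + z \<bullet> \<psi>' xb d = 0" "y \<bullet> h + z \<bullet> k \<le> 0"
        using dd hk unfolding dual_direction_def by blast+
      moreover have "y \<bullet> y = y \<bullet> \<phi>' xb d + y \<bullet> h"
        using arg_cong[OF yz(1), of "\<lambda>u. y \<bullet> u"] by (simp only: inner_add_right)
      moreover have "z \<bullet> z = z \<bullet> \<psi>' xb d + z \<bullet> k"
        using arg_cong[OF yz(2), of "\<lambda>u. z \<bullet> u"] by (simp only: inner_add_right)
      ultimately have "y \<bullet> y + z \<bullet> z \<le> 0" by linarith
      then have "y \<bullet> y = 0" "z \<bullet> z = 0"
        using inner_ge_zero[of y] inner_ge_zero[of z] by linarith+
      then show "y = 0 \<and> z = 0" by simp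
    qed
  next
    assume triv: "\<forall>y z. dual_direction y z \<longrightarrow> y = 0 \<and> z = 0"
    show "SRCQ \<phi> \<psi> P xb yb zb"
    proof (rule ccontr)
      assume "\<not> ?thesis"
      then have "D \<noteq> Yspace" by (simp add: SRCQ)
      then obtain a where a: "a \<in> Yspace" "a \<noteq> 0" "\<And>x. x \<in> D \<Longrightarrow> a \<bullet> x \<le> 0"
        using separate_proper_cone[OF subY \<open>convex D\<close> \<open>cone D\<close> \<open>D \<subseteq> Yspace\<close>] RD R0 by blast
      obtain y z where yz: "a = (y, z)" by (cases a)
      have "y \<bullet> \<phi>' xb d + z \<bullet> \<psi>' xb d = 0" for d
      proof -
        have "a \<bullet> (\<phi>' xb e, \<psi>' xb e) \<le> 0" for e
          using a(3) RD unfolding R_def by blast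
        from this[of d] this[of "- d"] show ?thesis
          by (simp add: yz blinfun.minus_right)
      qed
      moreover have "y \<bullet> h + z \<bullet> k \<le> 0" if "critical_pair h k" for h k
        using a(3)[of "(h, k)"] TD that by (auto simp: T_def yz)
      ultimately have "dual_direction y z"
        using a(1) by (auto simp: dual_direction_def yz Yspace_def sym_mats_def)
      then show False using triv a(2) by (auto simp: yz zero_prod_def)
    qed
  qed
qed

text \<open>The difference of two multipliers is a dual direction.\<close>

lemma multiplier_unique:
  assumes "SRCQ \<phi> \<psi> P xb yb zb" and yz: "(y, z) \<in> multipliers f \<phi> \<psi> P xb"
  shows "y = yb" "z = zb"
proof -
  interpret yz: kkt_point f \<phi> \<psi> f' f'' \<phi>' \<phi>'' \<psi>' \<psi>'' P xb y z
    by (unfold_locales) (rule polyP, rule yz)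
  have "dual_direction (y - yb) (z - zb)"
    unfolding dual_direction_def
  proof (intro conjI allI impI)
    show "transpose (y - yb) = y - yb" by (simp add: transpose_distribs sym_y yz.sym_y)
    show "(y - yb) \<bullet> \<phi>' xb d + (z - zb) \<bullet> \<psi>' xb d = 0" for d
      using gradL_inner[of y z xb d] gradL_inner[of yb zb xb d] multiplierD(1) yz.multiplierD(1)
      by (simp add: inner_diff_left)
    show "(y - yb) \<bullet> h + (z - zb) \<bullet> k \<le> 0" if "critical_pair h k" for h k
      using that yz.multiplier_polar[of h k] unfolding critical_pair_iff
      by (simp add: inner_diff_left)
  qed
  then have "y - yb = 0 \<and> z - zb = 0" using assms(1) unfolding SRCQ_iff by blast
  then show "y = yb" "z = zb" by simp_all
qed

lemma qform_eq:
  "qform f \<phi> \<psi> yb zb xb d = hessL f \<phi> \<psi> yb zb xb d \<bullet> d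
     + 2 * (yb \<bullet> (\<phi>' xb d ** pinv (- \<phi> xb) ** \<phi>' xb d))"
  unfolding qform_def Der_simps by (simp only: inner_commute)

lemma base_in_KKT_inv: "(xb, yb, zb) \<in> KKT_inv f \<phi> \<psi> P 0"
proof -
  have "(xb, yb, zb) \<in> KKT_inv f \<phi> \<psi> P (0, 0, 0)"
    unfolding KKT_inv_iff using multiplierD sym_y by simp
  then show ?thesis by (simp add: zero_prod_def)
qed

section \<open>Second-order sufficiency implies isolated calmness\<close>

text \<open>The linearization of the perturbed KKT system.  The residuals are of smaller order than \<open>t\<close>, so
  shifting the data by them, as \<open>KKT_inv_iff\<close> requires, does not change first-order limits.  When the
  primal part \<open>x\<close> is zero, all that is left of the system is that \<open>(y, z)\<close> is a dual direction.\<close>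

lemma KKT_sequence_limits:
  assumes t: "\<And>n. t n > 0" "t \<longlonglongrightarrow> 0"
    and mem: "\<And>n. (xb + t n *\<^sub>R dx n, yb + t n *\<^sub>R dy n, zb + t n *\<^sub>R dz n)
       \<in> KKT_inv f \<phi> \<psi> P (t n *\<^sub>R a n, t n *\<^sub>R b n, t n *\<^sub>R c n)"
    and lim: "dx \<longlonglongrightarrow> x" "dy \<longlonglongrightarrow> y" "dz \<longlonglongrightarrow> z" "a \<longlonglongrightarrow> 0" "b \<longlonglongrightarrow> 0" "c \<longlonglongrightarrow> 0"
  shows "hessL f \<phi> \<psi> yb zb xb x \<bullet> d + y \<bullet> \<phi>' xb d + z \<bullet> \<psi>' xb d = 0"
    and "critical_pair (\<phi>' xb x) (\<psi>' xb x)"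
    and "y \<bullet> \<phi>' xb x = 2 * (yb \<bullet> (\<phi>' xb x ** pinv (- \<phi> xb) ** \<phi>' xb x))"
    and "0 \<le> z \<bullet> \<psi>' xb x"
    and "x = 0 \<Longrightarrow> dual_direction y z"
proof -
  have ev: "\<forall>\<^sub>F n in sequentially. t n > 0" using t(1) by simp
  define Hn where "Hn n = (1 / t n) *\<^sub>R (\<phi> (xb + t n *\<^sub>R dx n) - \<phi> xb) + b n" for n
  define kn where "kn n = (1 / t n) *\<^sub>R (\<psi> (xb + t n *\<^sub>R dx n) - \<psi> xb) + c n" for n
  have "Hn \<longlonglongrightarrow> \<phi>' xb x + 0" unfolding Hn_def
    by (intro tendsto_add has_derivative_along[OF \<phi>' ev t(2)] lim)
  then have Hn: "Hn \<longlonglongrightarrow> \<phi>' xb x" by simp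
  have "kn \<longlonglongrightarrow> \<psi>' xb x + 0" unfolding kn_def
    by (intro tendsto_add has_derivative_along[OF \<psi>' ev t(2)] lim)
  then have kn: "kn \<longlonglongrightarrow> \<psi>' xb x" by simp
  have "(\<lambda>n. dy n - b n) \<longlonglongrightarrow> y - 0" by (intro tendsto_diff lim)
  then have En: "(\<lambda>n. dy n - b n) \<longlonglongrightarrow> y" by simp
  have "(\<lambda>n. dz n - c n) \<longlonglongrightarrow> z - 0" by (intro tendsto_diff lim)
  then have en: "(\<lambda>n. dz n - c n) \<longlonglongrightarrow> z" by simp
  have tH: "\<phi> (xb + t n *\<^sub>R dx n) + t n *\<^sub>R b n = - (- \<phi> xb - t n *\<^sub>R Hn n)" for n
    using t(1)[of n] by (simp add: Hn_def scaleR_add_right)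
  have tk: "\<psi> (xb + t n *\<^sub>R dx n) + t n *\<^sub>R c n = \<psi> xb + t n *\<^sub>R kn n" for n
    using t(1)[of n] by (simp add: kn_def scaleR_add_right)
  have ty: "yb + t n *\<^sub>R dy n - t n *\<^sub>R b n = yb + t n *\<^sub>R (dy n - b n)" for n
    by (simp add: scaleR_diff_right)
  have tz: "zb + t n *\<^sub>R dz n - t n *\<^sub>R c n = zb + t n *\<^sub>R (dz n - c n)" for n
    by (simp add: scaleR_diff_right)
  note mem' = mem[unfolded KKT_inv_iff tH tk ty tz minus_minus]
  have grad: "gradL f \<phi> \<psi> (yb + t n *\<^sub>R dy n) (zb + t n *\<^sub>R dz n) (xb + t n *\<^sub>R dx n) = t n *\<^sub>R a n" for n
    using mem' by blast
  have comp: "complementary_psd (- \<phi> xb - t n *\<^sub>R Hn n) (yb + t n *\<^sub>R (dy n - b n))" for n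
    using mem' by blast
  have inP: "\<psi> xb + t n *\<^sub>R kn n \<in> P" for n using mem' by blast
  have normal: "(zb + t n *\<^sub>R (dz n - c n)) \<bullet> (p - (\<psi> xb + t n *\<^sub>R kn n)) \<le> 0" if "p \<in> P" for n p
    using mem' that by blast
  note sdp = complementarity_limits[OF t Hn En comp]
  note poly = polyhedral_complementarity_limits[OF polyP multiplierD(3,4) t kn en inP normal]
  have "transpose (dy n) = dy n" for n
  proof -
    have "transpose (yb + t n *\<^sub>R dy n) = yb + t n *\<^sub>R dy n" using mem' by blast
    then show ?thesis using t(1)[of n] by (simp add: transpose_distribs sym_y)
  qed
  then have "dy \<longlonglongrightarrow> transpose y"
    using bounded_linear.tendsto[OF bounded_linear_transpose lim(2)] by simp
  then have sym: "transpose y = y" using LIMSEQ_unique lim(2) by blast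
  show eq: "hessL f \<phi> \<psi> yb zb xb x \<bullet> d + y \<bullet> \<phi>' xb d + z \<bullet> \<psi>' xb d = 0" for d
  proof -
    define xn where "xn n = xb + t n *\<^sub>R dx n" for n
    have "xn \<longlonglongrightarrow> xb + 0 *\<^sub>R x" unfolding xn_def by (intro tendsto_intros t lim)
    then have xn: "xn \<longlonglongrightarrow> xb" by simp
    have \<phi>n: "(\<lambda>n. \<phi>' (xn n) d) \<longlonglongrightarrow> \<phi>' xb d"
      by (intro blinfun.tendsto tendsto_const isCont_tendsto_compose[OF has_derivative_continuous[OF \<phi>''] xn])
    have \<psi>n: "(\<lambda>n. \<psi>' (xn n) d) \<longlonglongrightarrow> \<psi>' xb d"
      by (intro blinfun.tendsto tendsto_const isCont_tendsto_compose[OF has_derivative_continuous[OF \<psi>''] xn])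
    have "((1 / t n) *\<^sub>R (gradL f \<phi> \<psi> yb zb (xn n) - gradL f \<phi> \<psi> yb zb xb)) \<bullet> d
        + dy n \<bullet> \<phi>' (xn n) d + dz n \<bullet> \<psi>' (xn n) d = a n \<bullet> d" for n
    proof -
      have "t n * (a n \<bullet> d) = gradL f \<phi> \<psi> yb zb (xn n) \<bullet> d
          + t n * (dy n \<bullet> \<phi>' (xn n) d) + t n * (dz n \<bullet> \<psi>' (xn n) d)"
        using arg_cong[OF grad[of n], of "\<lambda>g. g \<bullet> d"] by (simp add: gradL_shift xn_def)
      then show ?thesis
        using t(1)[of n] by (simp add: multiplierD(1) field_simps)
    qed
    moreover have "(\<lambda>n. ((1 / t n) *\<^sub>R (gradL f \<phi> \<psi> yb zb (xn n) - gradL f \<phi> \<psi> yb zb xb)) \<bullet> d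
        + dy n \<bullet> \<phi>' (xn n) d + dz n \<bullet> \<psi>' (xn n) d)
      \<longlonglongrightarrow> hessL f \<phi> \<psi> yb zb xb x \<bullet> d + y \<bullet> \<phi>' xb d + z \<bullet> \<psi>' xb d"
      unfolding xn_def
      by (intro tendsto_add tendsto_inner tendsto_const has_derivative_along[OF hessL ev t(2) lim(1)]
          lim \<phi>n[unfolded xn_def] \<psi>n[unfolded xn_def])
    ultimately have "(\<lambda>n. a n \<bullet> d) \<longlonglongrightarrow> hessL f \<phi> \<psi> yb zb xb x \<bullet> d + y \<bullet> \<phi>' xb d + z \<bullet> \<psi>' xb d"
      by simp
    moreover have "(\<lambda>n. a n \<bullet> d) \<longlonglongrightarrow> 0 \<bullet> d" by (intro tendsto_inner lim tendsto_const)
    ultimately show ?thesis using LIMSEQ_unique by fastforce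
  qed
  show "critical_pair (\<phi>' xb x) (\<psi>' xb x)"
    unfolding critical_pair_def using sdp poly sym_derivative by blast
  show "y \<bullet> \<phi>' xb x = 2 * (yb \<bullet> (\<phi>' xb x ** pinv (- \<phi> xb) ** \<phi>' xb x))"
    by (rule graphical_derivative_curvature[OF sym sym_derivative sdp(1,2)])
  show "0 \<le> z \<bullet> \<psi>' xb x" by (rule poly(3))
  show "dual_direction y z" if "x = 0"
    unfolding dual_direction_def
  proof (intro conjI allI impI)
    have zero: "\<phi>' xb x = 0" "\<psi>' xb x = 0" by (simp_all add: that blinfun.zero_right)
    show "transpose y = y" by (rule sym)
    have "linear (hessL f \<phi> \<psi> yb zb xb)"
      by (rule bounded_linear.linear[OF has_derivative_bounded_linear[OF hessL]])
    then have "hessL f \<phi> \<psi> yb zb xb x = 0" by (simp add: that linear_0)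
    then show "y \<bullet> \<phi>' xb d + z \<bullet> \<psi>' xb d = 0" for d using eq[of d] by simp
    fix h k assume "critical_pair h k"
    then have h: "transpose h = h" "- (N ** h ** N) \<in> psd_mats" "yb \<bullet> h = 0"
      and k: "k \<in> radial_cone P (\<psi> xb)" "zb \<bullet> k = 0"
      by (simp_all add: critical_pair_def)
    have "y ** (- \<phi> xb) = 0" using sdp(1) by (simp add: zero matrix_distribs)
    then have "y \<bullet> h \<le> 0" by (rule critical_polar[OF _ sym sdp(3) h])
    moreover have "z \<bullet> k \<le> 0" by (rule poly(4)[OF _ _ zero(2) k])
    ultimately show "y \<bullet> h + z \<bullet> k \<le> 0" by simp
  qed
qed

text \<open>Pairing the linearized Lagrangian equation with \<open>x\<close> itself gives \<open>q(x) = - z \<bullet> \<psi>' x \<le> 0\<close>.\<close>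

theorem isolated_calm_if_SOSC_SRCQ:
  assumes SOSC: "SOSC f \<phi> \<psi> P xb" and SRCQ: "SRCQ \<phi> \<psi> P xb yb zb"
  shows "isolated_calm (KKT_inv f \<phi> \<psi> P) 0 (xb, yb, zb)"
proof (rule isolated_calmI[where F = "KKT_inv f \<phi> \<psi> P" and a = 0 and b = "(xb, yb, zb)",
      OF base_in_KKT_inv])
  fix t \<alpha> d D
  assume t: "\<And>n. t n > 0" "t \<longlonglongrightarrow> 0"
    and mem: "\<And>n. (xb, yb, zb) + t n *\<^sub>R d n \<in> KKT_inv f \<phi> \<psi> P (0 + t n *\<^sub>R \<alpha> n)"
    and \<alpha>: "\<alpha> \<longlonglongrightarrow> 0" and d: "d \<longlonglongrightarrow> D" and D: "norm D = 1"
  obtain x y z where xyz: "D = (x, y, z)" by (cases D)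
  define dx dy dz where "dx n = fst (d n)" and "dy n = fst (snd (d n))" and "dz n = snd (snd (d n))" for n
  define a b c where "a n = fst (\<alpha> n)" and "b n = fst (snd (\<alpha> n))" and "c n = snd (snd (\<alpha> n))" for n
  have d_eq: "d n = (dx n, dy n, dz n)" and \<alpha>_eq: "\<alpha> n = (a n, b n, c n)" for n
    by (simp_all add: dx_def dy_def dz_def a_def b_def c_def)
  have mem': "(xb + t n *\<^sub>R dx n, yb + t n *\<^sub>R dy n, zb + t n *\<^sub>R dz n)
       \<in> KKT_inv f \<phi> \<psi> P (t n *\<^sub>R a n, t n *\<^sub>R b n, t n *\<^sub>R c n)" for n
    using mem[of n] by (simp add: d_eq \<alpha>_eq)
  have lim: "dx \<longlonglongrightarrow> x" "dy \<longlonglongrightarrow> y" "dz \<longlonglongrightarrow> z"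
    using tendsto_fst[OF d] tendsto_fst[OF tendsto_snd[OF d]] tendsto_snd[OF tendsto_snd[OF d]]
    unfolding dx_def dy_def dz_def xyz by simp_all
  have lim': "a \<longlonglongrightarrow> 0" "b \<longlonglongrightarrow> 0" "c \<longlonglongrightarrow> 0"
    using tendsto_fst[OF \<alpha>] tendsto_fst[OF tendsto_snd[OF \<alpha>]] tendsto_snd[OF tendsto_snd[OF \<alpha>]]
    unfolding a_def b_def c_def by simp_all
  note limits = KKT_sequence_limits[OF t mem' lim lim']
  have "x = 0"
  proof (rule ccontr)
    assume "x \<noteq> 0"
    moreover have "x \<in> critical_cone f \<phi> \<psi> P xb"
      unfolding critical_cone_iff by (rule limits(2))
    ultimately have "(SUP (y, z) \<in> multipliers f \<phi> \<psi> P xb. ereal (qform f \<phi> \<psi> y z xb x)) > 0"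
      using SOSC unfolding SOSC_def by blast
    moreover have "multipliers f \<phi> \<psi> P xb = {(yb, zb)}"
    proof -
      have "w = (yb, zb)" if "w \<in> multipliers f \<phi> \<psi> P xb" for w
        using multiplier_unique[OF SRCQ] that by (cases w) blast
      then show ?thesis using multiplier by blast
    qed
    ultimately have "qform f \<phi> \<psi> yb zb xb x > 0" by simp
    then show False
      using limits(1)[of x] limits(3,4) unfolding qform_eq by linarith
  qed
  then have "dual_direction y z" by (rule limits(5))
  then have "y = 0 \<and> z = 0" using SRCQ unfolding SRCQ_iff by blast
  then show False using D \<open>x = 0\<close> by (simp add: xyz zero_prod_def[symmetric])
qed

section \<open>Consequences of isolated calmness\<close>

text \<open>A dual direction \<open>(\<delta>, \<zeta>)\<close> is followed by a curve of approximate multipliers over the fixed point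
  \<open>xb\<close>.  Testing \<open>\<delta>\<close> against the lineality space of the critical directions shows that it lives on
  \<open>ker S\<close>, and testing it against rank-one matrices shows that its biactive block is positive
  semidefinite; this is what \<open>psd_second_order_curve\<close> needs at \<open>yb\<close>.\<close>

theorem SRCQ_if_isolated_calm:
  assumes calm: "isolated_calm (KKT_inv f \<phi> \<psi> P) 0 (xb, yb, zb)"
  shows "SRCQ \<phi> \<psi> P xb yb zb"
  unfolding SRCQ_iff
proof (intro allI impI)
  fix \<delta> \<zeta> assume dd: "dual_direction \<delta> \<zeta>"
  then have sym: "transpose \<delta> = \<delta>" and adj: "\<And>d. \<delta> \<bullet> \<phi>' xb d + \<zeta> \<bullet> \<psi>' xb d = 0"
    and polar: "\<And>h k. critical_pair h k \<Longrightarrow> \<delta> \<bullet> h + \<zeta> \<bullet> k \<le> 0"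
    by (auto simp: dual_direction_def)
  have left: "\<delta> \<bullet> h \<le> 0" if "transpose h = h" "- (N ** h ** N) \<in> psd_mats" "yb \<bullet> h = 0" for h
    using polar[of h 0] that by (simp add: critical_pair_left)
  have right: "\<zeta> \<bullet> k \<le> 0" if "k \<in> radial_cone P (\<psi> xb)" "zb \<bullet> k = 0" for k
    using polar[of 0 k] that by (simp add: critical_pair_right)
  \<comment> \<open>Both \<open>v\<close> and \<open>- v\<close> are critical, so \<open>\<delta>\<close> is orthogonal to \<open>v\<close>, and \<open>v = 0\<close>.\<close>
  define v where "v = \<delta> - N ** \<delta> ** N"
  have NvN: "N ** v ** N = 0"
    by (simp add: v_def matrix_distribs matrix_mul_assoc pinv_S pinv_S(5)[THEN mult_assoc_cong])
  have symv: "transpose v = v"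
    by (simp add: v_def transpose_distribs sym pinv_S matrix_mul_assoc)
  have yv: "yb \<bullet> v = 0"
  proof -
    have "yb \<bullet> (N ** \<delta> ** N) = (N ** yb ** N) \<bullet> \<delta>" by (simp add: inner_congruence pinv_S)
    then show ?thesis by (simp add: v_def inner_diff_right Ny yN)
  qed
  have "\<delta> \<bullet> v \<le> 0" by (rule left) (simp_all add: symv NvN yv psd_zero)
  moreover have "\<delta> \<bullet> (- v) \<le> 0"
    by (rule left) (simp_all add: symv NvN yv psd_zero transpose_distribs matrix_distribs)
  ultimately have "\<delta> \<bullet> v = 0" by simp
  moreover have "(N ** \<delta> ** N) \<bullet> v = 0" by (simp add: inner_congruence pinv_S NvN)
  moreover have "v \<bullet> v = \<delta> \<bullet> v - (N ** \<delta> ** N) \<bullet> v"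
    unfolding v_def by (rule inner_diff_left)
  ultimately have "v \<bullet> v = 0" by simp
  then have N\<delta>N: "N ** \<delta> ** N = \<delta>" by (simp add: v_def)
  have S\<delta>: "(- \<phi> xb) ** \<delta> = 0"
  proof -
    have "(- \<phi> xb) ** \<delta> = ((- \<phi> xb) ** N) ** \<delta> ** N" 
      by (subst N\<delta>N[symmetric]) (simp only: matrix_mul_assoc)
    then show ?thesis unfolding pinv_S(6) by (simp add: matrix_distribs)
  qed
  have "0 \<le> x \<bullet> ((biactive ** \<delta> ** biactive) *v x)" for x
  proof -
    define c where "c = biactive *v x"
    have "yb *v c = 0" by (simp add: c_def matrix_vector_mul_assoc biactive_annihilates)
    then have "outer c \<bullet> yb = 0" by (simp add: outer_inner)
    then have "yb \<bullet> outer c = 0" by (simp only: inner_commute)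
    have "\<delta> \<bullet> (- outer c) \<le> 0"
    proof (rule left)
      have "transpose N ** outer c ** N \<in> psd_mats" by (rule psd_congruence[OF psd_outer])
      then show "- (N ** (- outer c) ** N) \<in> psd_mats" by (simp add: pinv_S matrix_distribs)
    qed (simp_all add: transpose_distribs transpose_outer \<open>yb \<bullet> outer c = 0\<close>)
    then have "0 \<le> \<delta> \<bullet> outer c" by simp
    also have "\<delta> \<bullet> outer c = c \<bullet> (\<delta> *v c)" by (subst inner_commute) (rule outer_inner)
    also have "c \<bullet> (\<delta> *v c) = x \<bullet> ((biactive ** \<delta> ** biactive) *v x)"
      unfolding c_def inner_mult_vec biactive_sym by (simp add: matrix_vector_mul_assoc matrix_mul_assoc)
    finally show ?thesis .
  qed
  then have "biactive ** \<delta> ** biactive \<in> psd_mats"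
    by (simp add: psd_mats_iff transpose_distribs biactive_sym sym matrix_mul_assoc)
  moreover have "ker_proj yb ** \<delta> ** ker_proj yb = biactive ** \<delta> ** biactive"
  proof -
    have "ker_proj yb ** \<delta> ** ker_proj yb = (ker_proj yb ** N) ** \<delta> ** (N ** ker_proj yb)"
      by (subst N\<delta>N[symmetric]) (simp only: matrix_mul_assoc)
    then show ?thesis by (simp only: biactive_eq'[symmetric] biactive_def[symmetric])
  qed
  ultimately have ker_proj\<delta>: "ker_proj yb ** \<delta> ** ker_proj yb \<in> psd_mats" by simp
  obtain M where M: "\<And>s. 0 \<le> s \<Longrightarrow> yb + s *\<^sub>R \<delta> + s\<^sup>2 *\<^sub>R M \<in> psd_mats"
    and M0: "\<And>S :: real^'p^'p. S ** yb = 0 \<Longrightarrow> S ** \<delta> = 0 \<Longrightarrow> S ** M = 0"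
    by (rule psd_second_order_curve[OF psd_y sym ker_proj\<delta>]) blast
  have SM: "(- \<phi> xb) ** M = 0" by (rule M0[OF Sy S\<delta>])
  \<comment> \<open>Along the curve the gradient is \<open>t\<^sup>2 g\<close>: the part linear in \<open>t\<close> cancels since \<open>(\<delta>, \<zeta>)\<close> is a dual direction.\<close>
  define g where "g = gradL f \<phi> \<psi> (yb + M) zb xb"
  define d where "d t = (0 :: 'x, \<delta> + t *\<^sub>R M, \<zeta>)" for t
  define \<alpha> where "\<alpha> t = (t *\<^sub>R g, 0 :: real^'p^'p, 0 :: 'z)" for t
  have perturb: "\<forall>\<^sub>F t in at_right 0. \<forall>p\<in>P. (zb + t *\<^sub>R \<zeta>) \<bullet> (p - \<psi> xb) \<le> 0"
    by (rule polyhedron_normal_perturbation[OF polyP multiplierD(3)])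
      (erule multiplierD(4), erule right, assumption)
  have curve: "\<forall>\<^sub>F t in at_right 0. (xb, yb, zb) + t *\<^sub>R d t \<in> KKT_inv f \<phi> \<psi> P (0 + t *\<^sub>R \<alpha> t)"
    using perturb eventually_at_right_less[of 0]
  proof eventually_elim
    case (elim t)
    have yt: "yb + t *\<^sub>R (\<delta> + t *\<^sub>R M) = yb + t *\<^sub>R \<delta> + t\<^sup>2 *\<^sub>R M"
      by (simp add: scaleR_add_right power2_eq_square)
    have psd: "yb + t *\<^sub>R \<delta> + t\<^sup>2 *\<^sub>R M \<in> psd_mats" using M elim(2) by simp
    have "(- \<phi> xb) ** (yb + t *\<^sub>R \<delta> + t\<^sup>2 *\<^sub>R M) = 0"
      unfolding mat_mult.add_right mat_mult.scaleR_right Sy S\<delta> SM by simp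
    then have comp: "complementary_psd (- \<phi> xb) (yb + t *\<^sub>R \<delta> + t\<^sup>2 *\<^sub>R M)"
      using psd_S psd by (simp add: complementary_psd_def)
    have grad: "gradL f \<phi> \<psi> (yb + t *\<^sub>R \<delta> + t\<^sup>2 *\<^sub>R M) (zb + t *\<^sub>R \<zeta>) xb = t\<^sup>2 *\<^sub>R g"
    proof (rule vector_eq_rdot[THEN iffD1], rule allI)
      fix e
      have "gradL f \<phi> \<psi> (yb + t *\<^sub>R \<delta> + t\<^sup>2 *\<^sub>R M) (zb + t *\<^sub>R \<zeta>) xb \<bullet> e
         = t * (\<delta> \<bullet> \<phi>' xb e + \<zeta> \<bullet> \<psi>' xb e) + t\<^sup>2 * (M \<bullet> \<phi>' xb e)"
        unfolding add.assoc[of yb] gradL_shift multiplierD(1)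
        by (simp add: inner_add_left distrib_left)
      also have "\<dots> = t\<^sup>2 * (g \<bullet> e)"
        using gradL_shift[of yb M zb 0 xb e] by (simp add: adj g_def multiplierD(1))
      finally show "gradL f \<phi> \<psi> (yb + t *\<^sub>R \<delta> + t\<^sup>2 *\<^sub>R M) (zb + t *\<^sub>R \<zeta>) xb \<bullet> e = (t\<^sup>2 *\<^sub>R g) \<bullet> e"
        by simp
    qed
    have "(xb, yb + t *\<^sub>R \<delta> + t\<^sup>2 *\<^sub>R M, zb + t *\<^sub>R \<zeta>) \<in> KKT_inv f \<phi> \<psi> P (t\<^sup>2 *\<^sub>R g, 0, 0)"
      unfolding KKT_inv_iff using comp grad elim(1) multiplierD(3) psd_symD[OF psd] by simp
    moreover have "(xb, yb, zb) + t *\<^sub>R d t = (xb, yb + t *\<^sub>R \<delta> + t\<^sup>2 *\<^sub>R M, zb + t *\<^sub>R \<zeta>)"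
      using yt by (simp add: d_def)
    moreover have "0 + t *\<^sub>R \<alpha> t = (t\<^sup>2 *\<^sub>R g, 0, 0)"
      by (simp add: \<alpha>_def power2_eq_square)
    ultimately show ?case by simp
  qed
  have d: "(d \<longlongrightarrow> (0, \<delta> + 0 *\<^sub>R M, \<zeta>)) (at_right 0)"
    unfolding d_def by (intro tendsto_intros)
  have "(\<alpha> \<longlongrightarrow> (0 *\<^sub>R g, 0, 0)) (at_right 0)"
    unfolding \<alpha>_def by (intro tendsto_intros)
  then have \<alpha>: "(\<alpha> \<longlongrightarrow> 0) (at_right 0)" by (simp add: zero_prod_def)
  have "(0, \<delta> + 0 *\<^sub>R M, \<zeta>) = (0 :: 'x \<times> (real^'p^'p) \<times> 'z)"
    by (rule isolated_calm_tangent[OF calm curve d \<alpha>])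
  then show "\<delta> = 0 \<and> \<zeta> = 0" by (simp add: zero_prod_def)
qed

text \<open>The points \<open>(xb + t x, yb, zb)\<close> have residual \<open>o(t)\<close>.  For the projection equation, \<open>(u\<^sub>t, v\<^sub>t)\<close> below is a
  point of \<open>K\<close> at distance \<open>o(t)\<close> from \<open>G(xb + t x)\<close> at which \<open>(yb, zb)\<close> is still normal, and the
  projection is nonexpansive.\<close>

theorem no_flat_critical_direction:
  assumes calm: "isolated_calm (KKT_inv f \<phi> \<psi> P) 0 (xb, yb, zb)"
    and x: "x \<in> critical_cone f \<phi> \<psi> P xb"
    and q: "qform f \<phi> \<psi> yb zb xb x = 0" and hess: "hessL f \<phi> \<psi> yb zb xb x = 0"
  shows "x = 0"
proof -
  define h where "h = \<phi>' xb x"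
  define k where "k = \<psi>' xb x"
  have h: "transpose h = h" "- (N ** h ** N) \<in> psd_mats" "yb \<bullet> h = 0"
    and k: "k \<in> radial_cone P (\<psi> xb)" "zb \<bullet> k = 0"
    using x unfolding critical_cone_iff critical_pair_def h_def k_def by blast+
  have "yb \<bullet> (h ** pinv (- \<phi> xb) ** h) = 0"
    using q unfolding qform_eq by (simp add: hess h_def)
  then have yh: "yb ** h = 0" by (rule zero_curvature[OF h])
  have h': "transpose (- h) = - h" "N ** (- h) ** N \<in> psd_mats"
    using h by (simp_all add: transpose_distribs matrix_distribs)
  obtain M where M: "\<And>s. 0 \<le> s \<Longrightarrow> - \<phi> xb + s *\<^sub>R (- h) + s\<^sup>2 *\<^sub>R M \<in> psd_mats"
    and M0: "\<And>y :: real^'p^'p. y ** (- \<phi> xb) = 0 \<Longrightarrow> y ** (- h) = 0 \<Longrightarrow> y ** M = 0"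
    by (rule psd_second_order_curve[OF psd_S h']) blast
  have yM: "yb ** M = 0" by (rule M0[OF yS]) (simp add: mat_mult.minus_right yh)
  define xt where "xt t = xb + t *\<^sub>R x" for t
  define ut where "ut t = \<phi> xb + t *\<^sub>R h - t\<^sup>2 *\<^sub>R M" for t
  define vt where "vt t = \<psi> xb + t *\<^sub>R k" for t
  define pr where "pr t = closest_point (Kset P) (Gmap \<phi> \<psi> (xt t) + (yb, zb))" for t
  define \<beta> where "\<beta> t = (1 / t) *\<^sub>R (pr t - Gmap \<phi> \<psi> (xt t))" for t
  define g where "g t = (1 / t) *\<^sub>R gradL f \<phi> \<psi> yb zb (xt t)" for t
  define r where "r t = (1 / t) *\<^sub>R (Gmap \<phi> \<psi> (xt t) - (ut t, vt t))" for t
  have pos: "\<forall>\<^sub>F t :: real in at_right 0. t > 0" by (rule eventually_at_right_less)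
  have id: "((\<lambda>t :: real. t) \<longlongrightarrow> 0) (at_right 0)" by (rule tendsto_ident_at)
  obtain s where s: "s > 0" "\<psi> xb + s *\<^sub>R k \<in> P"
    using k(1) radial_cone_iff[OF multiplierD(3)] by blast
  have small: "\<forall>\<^sub>F t :: real in at_right 0. t < s"
    using s(1) eventually_at_right_field by blast
  have "\<forall>\<^sub>F t in at_right 0. closest_point (Kset P) ((ut t, vt t) + (yb, zb)) = (ut t, vt t)"
    using pos small
  proof eventually_elim
    case (elim t)
    have S_eq: "- ut t = - \<phi> xb + t *\<^sub>R (- h) + t\<^sup>2 *\<^sub>R M" by (simp add: ut_def)
    have psd: "- ut t \<in> psd_mats" unfolding S_eq using M elim(1) by simp
    have "yb ** (- ut t) = 0"
      unfolding S_eq mat_mult.add_right mat_mult.scaleR_right mat_mult.minus_right[of yb h] yh yS yM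
      by simp
    then have "transpose (yb ** (- ut t)) = 0" by (simp add: transpose_distribs)
    then have "(- ut t) ** yb = 0" unfolding matrix_transpose_mul psd_symD[OF psd] sym_y .
    then have comp: "complementary_psd (- ut t) yb"
      using psd psd_y by (simp add: complementary_psd_def)
    have "vt t \<in> P"
      unfolding vt_def
      by (rule convex_step[OF polyhedron_imp_convex[OF polyP] multiplierD(3) s(2)]) (use elim in simp_all)
    moreover have "zb \<bullet> (p - vt t) \<le> 0" if "p \<in> P" for p
      using multiplierD(4)[OF that] by (simp add: vt_def k(2) inner_diff_right inner_add_right)
    ultimately have "(yb, zb) \<in> normal_cone Yspace (Kset P) (- (- ut t), vt t)"
      unfolding normal_cone_Kset_iff using comp by blast
    then show ?case
      unfolding closest_point_add_eq_iff[OF convex_K closed_K K_nonempty]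
      by (simp add: normal_cone_def)
  qed
  then have "\<forall>\<^sub>F t in at_right 0. norm (\<beta> t) \<le> 2 * norm (r t)"
    using pos
  proof eventually_elim
    case (elim t)
    have "dist (pr t) (ut t, vt t) \<le> dist (Gmap \<phi> \<psi> (xt t) + (yb, zb)) ((ut t, vt t) + (yb, zb))"
      using closest_point_lipschitz[OF convex_K closed_K K_nonempty,
          of "Gmap \<phi> \<psi> (xt t) + (yb, zb)" "(ut t, vt t) + (yb, zb)"]
      unfolding pr_def elim(1) .
    then have "norm (pr t - (ut t, vt t)) \<le> norm (Gmap \<phi> \<psi> (xt t) - (ut t, vt t))"
      by (simp only: dist_norm add_diff_cancel_right)
    then have "norm (pr t - Gmap \<phi> \<psi> (xt t)) \<le> 2 * norm (Gmap \<phi> \<psi> (xt t) - (ut t, vt t))"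
      using norm_triangle_ineq4[of "pr t - (ut t, vt t)" "Gmap \<phi> \<psi> (xt t) - (ut t, vt t)"] by simp
    then show ?case
      using elim(2) by (simp add: \<beta>_def r_def divide_right_mono)
  qed
  moreover have r: "(r \<longlongrightarrow> 0) (at_right 0)"
  proof -
    have "((\<lambda>t. ((1 / t) *\<^sub>R (\<phi> (xb + t *\<^sub>R x) - \<phi> xb) - h + t *\<^sub>R M,
        (1 / t) *\<^sub>R (\<psi> (xb + t *\<^sub>R x) - \<psi> xb) - k)) \<longlongrightarrow> (h - h + 0 *\<^sub>R M, k - k)) (at_right 0)"
      unfolding h_def k_def
      by (intro tendsto_Pair tendsto_add tendsto_diff tendsto_scaleR tendsto_const id
          has_derivative_along[OF \<phi>' pos id] has_derivative_along[OF \<psi>' pos id])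
    moreover have "\<forall>\<^sub>F t in at_right 0. ((1 / t) *\<^sub>R (\<phi> (xb + t *\<^sub>R x) - \<phi> xb) - h + t *\<^sub>R M,
        (1 / t) *\<^sub>R (\<psi> (xb + t *\<^sub>R x) - \<psi> xb) - k) = r t"
      using pos by (rule eventually_mono)
        (simp add: r_def xt_def ut_def vt_def Gmap_def algebra_simps power2_eq_square)
    ultimately show ?thesis by (simp add: tendsto_cong zero_prod_def)
  qed
  then have "((\<lambda>t. 2 * norm (r t)) \<longlongrightarrow> 0) (at_right 0)"
    using tendsto_mult_left[OF tendsto_norm[OF r], of 2] by simp
  ultimately have \<beta>: "(\<beta> \<longlongrightarrow> 0) (at_right 0)"
    by (rule Lim_null_comparison)
  have "((\<lambda>t. (1 / t) *\<^sub>R (gradL f \<phi> \<psi> yb zb (xb + t *\<^sub>R x) - gradL f \<phi> \<psi> yb zb xb))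
      \<longlongrightarrow> hessL f \<phi> \<psi> yb zb xb x) (at_right 0)"
    by (rule has_derivative_along[OF hessL pos id tendsto_const])
  then have g: "(g \<longlongrightarrow> 0) (at_right 0)"
    unfolding g_def[abs_def] xt_def hess multiplierD(1) by simp
  have curve: "\<forall>\<^sub>F t in at_right 0. (xb, yb, zb) + t *\<^sub>R (x, 0, 0) \<in> KKT_inv f \<phi> \<psi> P (0 + t *\<^sub>R (g t, \<beta> t))"
    using pos
  proof (rule eventually_mono)
    fix t :: real assume t: "t > 0"
    have "KKT f \<phi> \<psi> P (xt t, yb, zb) = t *\<^sub>R (g t, \<beta> t)"
      using t by (simp add: KKT_def pr_def[symmetric] g_def \<beta>_def)
    then show "(xb, yb, zb) + t *\<^sub>R (x, 0, 0) \<in> KKT_inv f \<phi> \<psi> P (0 + t *\<^sub>R (g t, \<beta> t))"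
      by (simp add: KKT_inv_def Yspace_def sym_mats_def sym_y xt_def)
  qed
  have \<alpha>: "((\<lambda>t. (g t, \<beta> t)) \<longlongrightarrow> 0) (at_right 0)"
    unfolding zero_prod_def by (intro tendsto_Pair g \<beta>[unfolded zero_prod_def])
  have "(x, 0, 0) = (0 :: 'x \<times> (real^'p^'p) \<times> 'z)"
    by (rule isolated_calm_tangent[OF calm curve tendsto_const \<alpha>])
  then show ?thesis by (simp add: zero_prod_def)
qed

end

section \<open>Isolated calmness, the strict Robinson condition and second-order sufficiency\<close>

theorem theorem4p1:
  fixes f :: "'x::euclidean_space \<Rightarrow> real"
    and \<phi> :: "'x \<Rightarrow> real^'p^'p"
    and \<psi> :: "'x \<Rightarrow> 'z::euclidean_space"
    and P :: "'z set"
    and xb :: 'x and yb :: "real^'p^'p" and zb :: 'z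
  assumes "twice_cont_diff f" and "twice_cont_diff \<phi>" and "twice_cont_diff \<psi>"
    and "\<And>x. \<phi> x \<in> sym_mats"
    and "polyhedron P" and "P \<noteq> {}"
    and "xb \<in> feasible_set \<phi> \<psi> P"
    and "stationary f \<phi> \<psi> P xb"
    and "(yb, zb) \<in> multipliers f \<phi> \<psi> P xb"
  shows "(SOSC f \<phi> \<psi> P xb \<and> SRCQ \<phi> \<psi> P xb yb zb
            \<longrightarrow> isolated_calm (KKT_inv f \<phi> \<psi> P) 0 (xb, yb, zb))
       \<and> (isolated_calm (KKT_inv f \<phi> \<psi> P) 0 (xb, yb, zb)
            \<longrightarrow> SRCQ \<phi> \<psi> P xb yb zb)
       \<and> (isolated_calm (KKT_inv f \<phi> \<psi> P) 0 (xb, yb, zb)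
            \<and> (\<forall>d \<in> critical_cone f \<phi> \<psi> P xb. qform f \<phi> \<psi> yb zb xb d \<ge> 0)
            \<and> (\<forall>d \<in> critical_cone f \<phi> \<psi> P xb.
                 qform f \<phi> \<psi> yb zb xb d = 0 \<longrightarrow> hessL f \<phi> \<psi> yb zb xb d = 0)
            \<longrightarrow> SOSC f \<phi> \<psi> P xb)"
proof -
  obtain f' f'' where f: "\<And>x. (f has_derivative blinfun_apply (f' x)) (at x)"
      "\<And>x. (f' has_derivative blinfun_apply (f'' x)) (at x)"
    by (rule twice_cont_diffE[OF assms(1)], rule that)
  obtain \<phi>' \<phi>'' where \<phi>: "\<And>x. (\<phi> has_derivative blinfun_apply (\<phi>' x)) (at x)"
      "\<And>x. (\<phi>' has_derivative blinfun_apply (\<phi>'' x)) (at x)"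
    by (rule twice_cont_diffE[OF assms(2)], rule that)
  obtain \<psi>' \<psi>'' where \<psi>: "\<And>x. (\<psi> has_derivative blinfun_apply (\<psi>' x)) (at x)"
      "\<And>x. (\<psi>' has_derivative blinfun_apply (\<psi>'' x)) (at x)"
    by (rule twice_cont_diffE[OF assms(3)], rule that)
  have sym: "transpose (\<phi> x) = \<phi> x" for x
    using assms(4)[of x] by (simp add: sym_mats_def)
  interpret kkt_point f \<phi> \<psi> f' f'' \<phi>' \<phi>'' \<psi>' \<psi>'' P xb yb zb
    by (intro kkt_point.intro smooth_program.intro kkt_point_axioms.intro f \<phi> \<psi> sym assms(5,9))
  have "SOSC f \<phi> \<psi> P xb"
    if calm: "isolated_calm (KKT_inv f \<phi> \<psi> P) 0 (xb, yb, zb)"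
      and nonneg: "\<forall>d \<in> critical_cone f \<phi> \<psi> P xb. qform f \<phi> \<psi> yb zb xb d \<ge> 0"
      and null: "\<forall>d \<in> critical_cone f \<phi> \<psi> P xb.
                 qform f \<phi> \<psi> yb zb xb d = 0 \<longrightarrow> hessL f \<phi> \<psi> yb zb xb d = 0"
    unfolding SOSC_def
  proof (intro ballI impI)
    fix d assume d: "d \<in> critical_cone f \<phi> \<psi> P xb" "d \<noteq> 0"
    have "qform f \<phi> \<psi> yb zb xb d \<noteq> 0"
      using no_flat_critical_direction[OF calm d(1)] null d by blast
    then have "0 < ereal (qform f \<phi> \<psi> yb zb xb d)"
      using nonneg d(1) by (auto simp: order_less_le)
    also have "\<dots> \<le> (SUP (y, z) \<in> multipliers f \<phi> \<psi> P xb. ereal (qform f \<phi> \<psi> y z xb d))"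
      using assms(9) by (intro SUP_upper2[of "(yb, zb)"]) auto
    finally show "(SUP (y, z) \<in> multipliers f \<phi> \<psi> P xb. ereal (qform f \<phi> \<psi> y z xb d)) > 0" .
  qed
  then show ?thesis
    using isolated_calm_if_SOSC_SRCQ SRCQ_if_isolated_calm by blast
qed

end
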